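(* Let $\alpha,b,x_1,\dots,x_n,a_1,\dots,a_n$ be complex parameters such that no denominator in the identity below vanishes. Let $f(y)$ be a complex function of one variable (defined at all points where it is evaluated below). Assume that either (i) $f$ is such that both sides of the identity are analytic in $a_1,\dots,a_n$ and the series converges absolutely for each $a_r$ in a disk around the origin, and each $a_r$ lies in this disk; or (ii) $a_r=q^{N_r}$ with $N_r$ a positive integer for $r=1,\dots,n$ (so that the series terminates). Then $$\begin{aligned} & f(\alpha a_{1}\cdots a_{n}q^{1-n})\prod_{r=1}^{n}\frac{(\alpha qx_{r},\alpha a_{r}bx_{r}/q)_{\infty}}{(\alpha bx_{r},\alpha a_{r}x_{r})_{\infty}}\\ &=\sum_{k_1,\dots,k_n\ge0}\ \prod_{1\leq r<s\leq n}\frac{1-q^{k_{r}-k_{s}}x_{r}/x_{s}}{1-x_{r}/x_{s}}\prod_{r,s=1}^{n}\frac{(qx_{r}/(x_{s}a_{s}))_{k_{r}}}{(qx_{r}/x_{s})_{k_{r}}}\\ &\quad\times\prod_{r=1}^{n}\frac{1-\alpha x_{r}q^{k_{r}+|\boldsymbol{k}|}}{1-\alpha x_{r}}\prod_{r=1}^{n}\frac{(\alpha x_{r})_{|\boldsymbol{k}|}}{(\alpha x_{r}a_{r})_{|\boldsymbol{k}|}}(a_{1}\cdots a_{n})^{|\boldsymbol{k}|}q^{\sum_{r=1}^{n}(r-1)k_{r}-n|\boldsymbol{k}|}\\ &\quad\times\sum_{\substack{0\leq m_{r}\leq k_{r}\\ r=1,\dots,n}}\ \prod_{1\leq r<s\leq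 n}\frac{1-q^{m_{r}-m_{s}}x_{r}/x_{s}}{1-x_{r}/x_{s}}\prod_{r,s=1}^{n}\frac{(q^{-k_{s}}x_{r}/x_{s})_{m_{r}}}{(qx_{r}/x_{s})_{m_{r}}}\prod_{r=1}^{n}\frac{(\alpha x_{r}q^{|\boldsymbol{k}|})_{m_{r}}}{(\alpha bx_{r})_{m_{r}}}\,q^{\sum_{r=1}^{n}rm_{r}}f(\alpha q^{1+|\boldsymbol{m}|}). \end{aligned}$$
   Context: $q$ is a complex number with $0<|q|<1$ and $n\ge1$ is an integer. $(z)_\infty=\prod_{i\ge0}(1-zq^i)$ and $(z)_k=(z)_\infty/(zq^k)_\infty=\prod_{i=0}^{k-1}(1-zq^i)$; $(c_1,\dots,c_p)_k=(c_1)_k\cdots(c_p)_k$ for $k$ a nonnegative integer or $\infty$. Bold letters denote multi-indices of nonnegative integers, $\boldsymbol k=(k_1,\dots,k_n)$, with $|\boldsymbol k|=k_1+\cdots+k_n$. If some $a_s=0$, the expression $\prod_{r,s}(qx_r/(x_sa_s))_{k_r}(a_1\cdots a_n)^{|\boldsymbol k|}$, which is polynomial in the $a_s$, is understood by continuity. *)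

theory Defs
  imports "HOL-Analysis.Analysis"
begin

definition qpoch :: "complex \<Rightarrow> complex \<Rightarrow> nat \<Rightarrow> complex" where
  "qpoch q z k = (\<Prod>i<k. 1 - z * q ^ i)"

definition qpoch_inf :: "complex \<Rightarrow> complex \<Rightarrow> complex" where
  "qpoch_inf q z = (\<Prod>i. 1 - z * q ^ i)"

text \<open>Points of complex n-space and multi-indices are functions on nat of which only the values at
  1, ..., n matter. Multi-indices are extensional, so that distinct multi-indices are distinct
  functions.\<close>

definition multi_indices :: "nat \<Rightarrow> (nat \<Rightarrow> nat) set" where
  "multi_indices n = {1..n} \<rightarrow>\<^sub>E UNIV"

definition msize :: "nat \<Rightarrow> (nat \<Rightarrow> nat) \<Rightarrow> nat" where
  "msize n k = (\<Sum>r=1..n. k r)"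

definition polydisc :: "nat \<Rightarrow> (nat \<Rightarrow> complex) \<Rightarrow> real \<Rightarrow> (nat \<Rightarrow> complex) set" where
  "polydisc n c R = {z. \<forall>r\<in>{1..n}. z r \<in> ball (c r) R}"

text \<open>Joint analyticity in n variables: locally the sum of an (absolutely) convergent power series.\<close>

definition multi_analytic_on ::
    "nat \<Rightarrow> ((nat \<Rightarrow> complex) \<Rightarrow> complex) \<Rightarrow> (nat \<Rightarrow> complex) set \<Rightarrow> bool" where
  "multi_analytic_on n F D \<longleftrightarrow>
     (\<forall>c\<in>D. \<exists>\<rho>>0. \<exists>C :: (nat \<Rightarrow> nat) \<Rightarrow> complex. \<forall>z\<in>polydisc n c \<rho>.
        ((\<lambda>\<nu>. C \<nu> * (\<Prod>r=1..n. (z r - c r) ^ \<nu> r)) has_sum F z) (multi_indices n))"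

definition vandermonde_ratio ::
    "nat \<Rightarrow> complex \<Rightarrow> (nat \<Rightarrow> complex) \<Rightarrow> (nat \<Rightarrow> nat) \<Rightarrow> complex" where
  "vandermonde_ratio n q x k =
     (\<Prod>r=1..n. \<Prod>s=r+1..n.
        (1 - q powi (int (k r) - int (k s)) * x r / x s) / (1 - x r / x s))"

text \<open>The continuous extension to all values of a of the product over r and s of
  \<open>qpoch q (q x\<^sub>r / (x\<^sub>s a\<^sub>s)) k\<^sub>r\<close> times \<open>(a\<^sub>1 \<cdots> a\<^sub>n) ^ |k|\<close>;
  the two lemmas below say that it is continuous and has that value when no \<open>a\<^sub>s\<close> is zero.\<close>

definition a_factor ::
    "nat \<Rightarrow> complex \<Rightarrow> (nat \<Rightarrow> complex) \<Rightarrow> (nat \<Rightarrow> complex) \<Rightarrow> (nat \<Rightarrow> nat) \<Rightarrow> complex" where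
  "a_factor n q x a k =
     (\<Prod>r=1..n. \<Prod>s=1..n. \<Prod>i<k r. a s - q * x r / x s * q ^ i)"

lemma a_factor_nonzero:
  assumes "\<forall>s\<in>{1..n}. a s \<noteq> 0"
  shows "a_factor n q x a k =
    (\<Prod>r=1..n. \<Prod>s=1..n. qpoch q (q * x r / (x s * a s)) (k r)) * (\<Prod>s=1..n. a s) ^ msize n k"
proof -
  have eq: "(\<Prod>i<k r. a s - q * x r / x s * q ^ i) = qpoch q (q * x r / (x s * a s)) (k r) * a s ^ k r"
    if "s \<in> {1..n}" for r s
  proof -
    have "(\<Prod>i<k r. a s - q * x r / x s * q ^ i) = (\<Prod>i<k r. (1 - q * x r / (x s * a s) * q ^ i) * a s)"
      using assms that by (intro prod.cong) (auto simp: left_diff_distrib)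
    then show ?thesis by (simp add: prod.distrib qpoch_def)
  qed
  have "a_factor n q x a k =
      (\<Prod>r=1..n. \<Prod>s=1..n. qpoch q (q * x r / (x s * a s)) (k r) * a s ^ k r)"
    unfolding a_factor_def by (intro prod.cong refl eq)
  also have "\<dots> = (\<Prod>r=1..n. \<Prod>s=1..n. qpoch q (q * x r / (x s * a s)) (k r)) *
      (\<Prod>r=1..n. (\<Prod>s=1..n. a s) ^ k r)"
    by (simp add: prod.distrib prod_power_distrib)
  also have "(\<Prod>r=1..n. (\<Prod>s=1..n. a s) ^ k r) = (\<Prod>s=1..n. a s) ^ msize n k"
    by (simp add: msize_def power_sum)
  finally show ?thesis .
qed

lemma continuous_on_a_factor: "continuous_on UNIV (\<lambda>a. a_factor n q x a k)"
  unfolding a_factor_def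
  by (intro continuous_intros continuous_on_product_coordinates)

definition expansion_lhs ::
    "nat \<Rightarrow> complex \<Rightarrow> complex \<Rightarrow> complex \<Rightarrow> (nat \<Rightarrow> complex) \<Rightarrow> (complex \<Rightarrow> complex)
      \<Rightarrow> (nat \<Rightarrow> complex) \<Rightarrow> complex" where
  "expansion_lhs n q \<alpha> b x f a =
     f (\<alpha> * (\<Prod>r=1..n. a r) * q powi (1 - int n)) *
     (\<Prod>r=1..n. (qpoch_inf q (\<alpha> * q * x r) * qpoch_inf q (\<alpha> * a r * b * x r / q)) /
                 (qpoch_inf q (\<alpha> * b * x r) * qpoch_inf q (\<alpha> * a r * x r)))"

definition inner_sum ::
    "nat \<Rightarrow> complex \<Rightarrow> complex \<Rightarrow> complex \<Rightarrow> (nat \<Rightarrow> complex) \<Rightarrow> (complex \<Rightarrow> complex)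
      \<Rightarrow> (nat \<Rightarrow> nat) \<Rightarrow> complex" where
  "inner_sum n q \<alpha> b x f k =
     (\<Sum>m \<in> (\<Pi>\<^sub>E r\<in>{1..n}. {0..k r}).
        vandermonde_ratio n q x m *
        (\<Prod>r=1..n. \<Prod>s=1..n.
           qpoch q (q powi (- int (k s)) * x r / x s) (m r) / qpoch q (q * x r / x s) (m r)) *
        (\<Prod>r=1..n. qpoch q (\<alpha> * x r * q ^ msize n k) (m r) / qpoch q (\<alpha> * b * x r) (m r)) *
        q ^ (\<Sum>r=1..n. r * m r) *
        f (\<alpha> * q ^ (1 + msize n m)))"

definition expansion_term ::
    "nat \<Rightarrow> complex \<Rightarrow> complex \<Rightarrow> complex \<Rightarrow> (nat \<Rightarrow> complex) \<Rightarrow> (complex \<Rightarrow> complex)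
      \<Rightarrow> (nat \<Rightarrow> complex) \<Rightarrow> (nat \<Rightarrow> nat) \<Rightarrow> complex" where
  "expansion_term n q \<alpha> b x f a k =
     vandermonde_ratio n q x k *
     (a_factor n q x a k / (\<Prod>r=1..n. \<Prod>s=1..n. qpoch q (q * x r / x s) (k r))) *
     (\<Prod>r=1..n. (1 - \<alpha> * x r * q ^ (k r + msize n k)) / (1 - \<alpha> * x r)) *
     (\<Prod>r=1..n. qpoch q (\<alpha> * x r) (msize n k) / qpoch q (\<alpha> * x r * a r) (msize n k)) *
     q powi ((\<Sum>r=1..n. (int r - 1) * int (k r)) - int n * int (msize n k)) *
     inner_sum n q \<alpha> b x f k"

definition expansion_rhs ::
    "nat \<Rightarrow> complex \<Rightarrow> complex \<Rightarrow> complex \<Rightarrow> (nat \<Rightarrow> complex) \<Rightarrow> (complex \<Rightarrow> complex)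
      \<Rightarrow> (nat \<Rightarrow> complex) \<Rightarrow> complex" where
  "expansion_rhs n q \<alpha> b x f a = (\<Sum>\<^sub>\<infinity>k\<in>multi_indices n. expansion_term n q \<alpha> b x f a k)"

text \<open>The \<open>a\<^sub>s\<close> themselves may be zero, in view of the convention built into \<open>a_factor\<close>.\<close>

definition denominators_nonzero ::
    "nat \<Rightarrow> complex \<Rightarrow> complex \<Rightarrow> complex \<Rightarrow> (nat \<Rightarrow> complex) \<Rightarrow> (nat \<Rightarrow> complex) \<Rightarrow> bool" where
  "denominators_nonzero n q \<alpha> b x a \<longleftrightarrow>
     (\<forall>r\<in>{1..n}. x r \<noteq> 0 \<and> 1 - \<alpha> * x r \<noteq> 0 \<and>
        qpoch_inf q (\<alpha> * b * x r) \<noteq> 0 \<and> qpoch_inf q (\<alpha> * a r * x r) \<noteq> 0 \<and>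
        (\<forall>j. qpoch q (\<alpha> * b * x r) j \<noteq> 0 \<and> qpoch q (\<alpha> * x r * a r) j \<noteq> 0)) \<and>
     (\<forall>r\<in>{1..n}. \<forall>s\<in>{1..n}. r < s \<longrightarrow> 1 - x r / x s \<noteq> 0) \<and>
     (\<forall>r\<in>{1..n}. \<forall>s\<in>{1..n}. \<forall>j. qpoch q (q * x r / x s) j \<noteq> 0)"

end

theory Submission
  imports Defs "HOL-Complex_Analysis.Complex_Analysis"
begin

text \<open>When \<open>a\<^sub>r = q ^ (M r + 1)\<close>, comparing coefficients of the values of \<open>f\<close> reduces the identity to
  the inversion of two triangular matrices indexed by multi-indices. The product of these matrices in
  the opposite order is much easier to evaluate: with \<open>z\<^sub>r = x\<^sub>r q ^ k\<^sub>r\<close> its entries are multiples of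
  \<open>\<Sum>\<^sub>k \<Prod>\<^sub>r\<^sub><\<^sub>s (z\<^sub>s - z\<^sub>r) \<Prod>\<^sub>r P(z\<^sub>r) / \<omega>'(z\<^sub>r)\<close>, where \<open>\<omega>\<close> vanishes at the nodes
  \<open>x\<^sub>s q ^ i\<close> (\<open>i \<le> M s\<close>) and \<open>deg P < |M|\<close>. Extending the range of one \<open>z\<^sub>r\<close> to all nodes makes
  the sum zero by Lagrange interpolation, and the terms added cancel by antisymmetry. The analytic
  case follows from the identity theorem in one variable after another, as the points \<open>q ^ N\<close>
  accumulate at 0.\<close>

subsection \<open>Sums over nodes against a Vandermonde product\<close>

text \<open>The order of the two matrices decides how hard their product is. In the order that the
  identity needs, the total |k| of the summation index sits inside the Pochhammer symbols of both
  matrices and couples all the k_r. In the opposite order these symbols contain only the totals of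
  the two fixed outer indices, so apart from the Vandermonde product the summand is a product of
  factors each depending on a single k_r, in fact on the node x_r q^(k_r). The parameters b and f
  enter only as weights attached to the inner index, which is why the inversion does not involve
  them. One obstacle remains. With a_r = q^(M_r + 1), nonvanishing denominators exclude
  \<open>\<alpha> * x r * q ^ i = 1\<close> only for i = 0 and i > M_r. The exponents from 1 to M_r
  may still occur, and for them the square matrix is undefined although the row used by the series
  is not. Hence the detour through generic \<alpha> and continuity.\<close>

lemma sum_poly_div_nodes_eq_0:
  fixes p :: "'a::field poly"
  assumes fin: "finite Y" and deg: "degree p + 2 \<le> card Y"
  shows "(\<Sum>y\<in>Y. poly p y / (\<Prod>u\<in>Y-{y}. y - u)) = 0"
proof -
  define L where "L y = (\<Prod>u\<in>Y-{y}. [:-u, 1:])" for y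
  define c where "c y = poly p y / (\<Prod>u\<in>Y-{y}. y - u)" for y
  define g where "g = (\<Sum>y\<in>Y. smult (c y) (L y)) - p"
  have degL: "degree (L y) = card Y - 1" and lead: "coeff (L y) (card Y - 1) = 1" if "y \<in> Y" for y
  proof -
    show d: "degree (L y) = card Y - 1"
      unfolding L_def by (subst degree_prod_eq_sum_degree) (use that fin in \<open>auto simp: card_Diff_singleton\<close>)
    have "lead_coeff (L y) = 1"
      unfolding L_def by (simp add: lead_coeff_prod)
    then show "coeff (L y) (card Y - 1) = 1" by (simp add: d)
  qed
  have "degree (\<Sum>y\<in>Y. smult (c y) (L y)) \<le> card Y - 1"
    by (intro degree_sum_le fin) (metis degL degree_smult_le)
  then have "degree g \<le> card Y - 1"
    unfolding g_def using deg by (intro degree_diff_le) auto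
  then have dg: "degree g < card Y" using deg by linarith
  have roots: "poly g v = 0" if v: "v \<in> Y" for v
  proof -
    have "poly (\<Sum>y\<in>Y. smult (c y) (L y)) v = (\<Sum>y\<in>Y. c y * (\<Prod>u\<in>Y-{y}. v - u))"
      by (simp add: poly_sum L_def poly_prod)
    also have "\<dots> = (\<Sum>y\<in>Y. if y = v then poly p v else 0)"
    proof (intro sum.cong refl)
      fix y assume y: "y \<in> Y"
      show "c y * (\<Prod>u\<in>Y-{y}. v - u) = (if y = v then poly p v else 0)"
      proof (cases "y = v")
        case True
        have "(\<Prod>u\<in>Y-{v}. v - u) \<noteq> 0" using fin by auto
        with True show ?thesis by (simp add: c_def)
      next
        case False
        with v fin have "(\<Prod>u\<in>Y-{y}. v - u) = 0" by (auto intro!: bexI[of _ v])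
        with False show ?thesis by simp
      qed
    qed
    also have "\<dots> = poly p v" using v fin by simp
    finally show ?thesis by (simp add: g_def)
  qed
  have "g = 0"
  proof (rule ccontr)
    assume "g \<noteq> 0"
    then have "card Y \<le> degree g"
      using roots card_mono[OF poly_roots_finite, of g Y] card_poly_roots_bound[of g] by fastforce
    with dg show False by simp
  qed
  \<comment> \<open>Each \<open>L y\<close> is monic of degree \<open>card Y - 1\<close>, so the top
    coefficient of the interpolant is the sum of the \<open>c y\<close>, which is the sum in
    question.\<close>
  then have "coeff (\<Sum>y\<in>Y. smult (c y) (L y)) (card Y - 1) = coeff p (card Y - 1)"
    by (simp add: g_def)
  also have "coeff p (card Y - 1) = 0" using deg by (intro coeff_eq_0) linarith
  finally show ?thesis by (simp add: coeff_sum lead[unfolded One_nat_def] c_def)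
qed

text \<open>The index set is arbitrary because single indices will be split off from it.\<close>

definition vandermonde :: "nat set \<Rightarrow> (nat \<Rightarrow> 'a) \<Rightarrow> 'a::comm_ring_1" where
  "vandermonde I z = (\<Prod>r\<in>I. \<Prod>s\<in>{s\<in>I. r < s}. z s - z r)"

lemma vandermonde_cong: "(\<And>i. i \<in> I \<Longrightarrow> z i = z' i) \<Longrightarrow> vandermonde I z = vandermonde I z'"
  unfolding vandermonde_def by (intro prod.cong refl) auto

text \<open>The signs come from the indices below a, whose differences with \<open>z a\<close> occur
  in the reverse direction. This form exhibits the dependence on \<open>z a\<close> alone as a
  product of \<open>card I - 1\<close> linear factors.\<close>

lemma vandermonde_remove:
  assumes fin: "finite I" and a: "a \<in> I"
  shows "vandermonde I z =
    (\<Prod>r\<in>I-{a}. if r < a then -1 else 1) * (\<Prod>r\<in>I-{a}. z r - z a) * vandermonde (I - {a}) z"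
proof -
  have 1: "(\<Prod>s\<in>{s\<in>I. a < s}. z s - z a) = (\<Prod>r\<in>I-{a}. if a < r then z r - z a else 1)"
    using fin by (intro prod.mono_neutral_cong_left) auto
  have 2: "(\<Prod>s\<in>{s\<in>I. r < s}. z s - z r) =
     (if r < a then z a - z r else 1) * (\<Prod>s\<in>{s\<in>I-{a}. r < s}. z s - z r)" if "r \<in> I-{a}" for r
  proof (cases "r < a")
    case True
    then have "{s\<in>I. r < s} = insert a {s\<in>I-{a}. r < s}" using a by auto
    then show ?thesis using True fin by simp
  next
    case False
    then have "{s\<in>I. r < s} = {s\<in>I-{a}. r < s}" by auto
    then show ?thesis using False by simp
  qed
  have "vandermonde I z = (\<Prod>s\<in>{s\<in>I. a < s}. z s - z a) *
      (\<Prod>r\<in>I-{a}. \<Prod>s\<in>{s\<in>I. r < s}. z s - z r)"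
    unfolding vandermonde_def using prod.remove[OF fin a] by blast
  also have "\<dots> = (\<Prod>r\<in>I-{a}. if a < r then z r - z a else 1) *
      ((\<Prod>r\<in>I-{a}. if r < a then z a - z r else 1) * vandermonde (I - {a}) z)"
    unfolding 1 vandermonde_def prod.distrib[symmetric] using 2 by simp
  also have "\<dots> = (\<Prod>r\<in>I-{a}. (if a < r then z r - z a else 1) * (if r < a then z a - z r else 1))
      * vandermonde (I - {a}) z" by (simp add: prod.distrib mult.assoc)
  also have "(\<Prod>r\<in>I-{a}. (if a < r then z r - z a else 1) * (if r < a then z a - z r else 1))
      = (\<Prod>r\<in>I-{a}. (if r < a then -1 else 1) * (z r - z a))"
    by (intro prod.cong) auto
  finally show ?thesis by (simp add: prod.distrib)
qed

text \<open>Once both a and b are split off, \<open>y b - y a\<close> is the only factor that is not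
  symmetric in the two values.\<close>

lemma vandermonde_swap:
  fixes z :: "nat \<Rightarrow> 'a::comm_ring_1"
  assumes fin: "finite I" and ab: "a \<in> I" "b \<in> I" "a \<noteq> b"
  shows "vandermonde I (z(a := z b, b := z a)) = - vandermonde I z"
proof -
  have expand: "vandermonde I y = (\<Prod>r\<in>I-{a}. if r < a then -1 else 1) *
      (\<Prod>r\<in>I-{a}-{b}. if r < b then -1 else 1) * (y b - y a) *
      (\<Prod>r\<in>I-{a}-{b}. (y r - y a) * (y r - y b)) * vandermonde (I-{a}-{b}) y"
    for y :: "nat \<Rightarrow> 'a"
  proof -
    have b: "b \<in> I - {a}" using ab by auto
    have 1: "vandermonde (I-{a}) y = (\<Prod>r\<in>I-{a}-{b}. if r < b then -1 else 1) *
        (\<Prod>r\<in>I-{a}-{b}. y r - y b) * vandermonde (I-{a}-{b}) y"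
      by (rule vandermonde_remove[OF _ b]) (use fin in simp)
    have 2: "(\<Prod>r\<in>I-{a}. y r - y a) = (y b - y a) * (\<Prod>r\<in>I-{a}-{b}. y r - y a)"
      by (rule prod.remove[OF _ b]) (use fin in simp)
    show ?thesis
      unfolding vandermonde_remove[OF fin ab(1), of y] 1 2 prod.distrib by (simp only: mult_ac)
  qed
  let ?y = "z(a := z b, b := z a)"
  have 1: "vandermonde (I-{a}-{b}) ?y = vandermonde (I-{a}-{b}) z"
    by (intro vandermonde_cong) auto
  have 2: "(\<Prod>r\<in>I-{a}-{b}. (?y r - ?y a) * (?y r - ?y b)) = (\<Prod>r\<in>I-{a}-{b}. (z r - z a) * (z r - z b))"
    using ab by (intro prod.cong) auto
  show ?thesis
    unfolding expand[of ?y] expand[of z] 1 2 using ab by (simp add: algebra_simps)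
qed

lemma prod_differences_eq_vandermonde_square:
  assumes fin: "finite I"
  shows "(\<Prod>s\<in>I. \<Prod>r\<in>I-{s}. z s - z r) =
    (\<Prod>s\<in>I. \<Prod>r\<in>{r\<in>I. s < r}. -1) * (vandermonde I z)\<^sup>2"
proof -
  have "(\<Prod>r\<in>I-{s}. z s - z r) = (\<Prod>r\<in>{r\<in>I. r < s}. z s - z r) * (\<Prod>r\<in>{r\<in>I. s < r}. z s - z r)"
    if "s \<in> I" for s
    using fin by (subst prod.union_disjoint[symmetric]) (auto intro!: prod.cong)
  then have "(\<Prod>s\<in>I. \<Prod>r\<in>I-{s}. z s - z r) =
    (\<Prod>s\<in>I. \<Prod>r\<in>{r\<in>I. r < s}. z s - z r) * (\<Prod>s\<in>I. \<Prod>r\<in>{r\<in>I. s < r}. z s - z r)"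
    by (simp add: prod.distrib)
  also have "(\<Prod>s\<in>I. \<Prod>r\<in>{r\<in>I. r < s}. z s - z r) = vandermonde I z"
    unfolding vandermonde_def by (rule prod.swap_restrict[OF fin fin])
  also have "(\<Prod>s\<in>I. \<Prod>r\<in>{r\<in>I. s < r}. z s - z r) =
     (\<Prod>s\<in>I. \<Prod>r\<in>{r\<in>I. s < r}. (-1) * (z r - z s))" by simp
  also have "\<dots> = (\<Prod>s\<in>I. \<Prod>r\<in>{r\<in>I. s < r}. -1) * vandermonde I z"
    unfolding vandermonde_def prod.distrib[symmetric] ..
  finally show ?thesis by (simp add: power2_eq_square mult_ac)
qed

text \<open>The degree bound is that of Lagrange interpolation in one variable: the Vandermonde
  product adds \<open>card I - 1\<close> to the degree of p, and the total has to be at most the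
  number of nodes minus 2.\<close>

lemma sum_vandermonde_nodes_eq_0:
  fixes p :: "'a::field_char_0 poly" and Y :: "nat \<Rightarrow> 'a set"
  assumes fin: "finite I" and ne: "I \<noteq> {}" and finY: "\<And>r. r \<in> I \<Longrightarrow> finite (Y r)"
    and disj: "disjoint_family_on Y I"
    and deg: "degree p + card I < card (\<Union>r\<in>I. Y r)"
  shows "(\<Sum>z\<in>Pi\<^sub>E I Y. vandermonde I z *
    (\<Prod>r\<in>I. poly p (z r) / (\<Prod>u\<in>(\<Union>r\<in>I. Y r)-{z r}. z r - u))) = 0"
proof -
  define U where "U = (\<Union>r\<in>I. Y r)"
  define w where "w y = poly p y / (\<Prod>u\<in>U-{y}. y - u)" for y
  obtain a where a: "a \<in> I" using ne by auto
  define J where "J = I - {a}"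
  have IJ: "I = insert a J" "a \<notin> J" "finite J" using a fin by (auto simp: J_def)
  define F where "F y g = vandermonde I (g(a := y)) * w y * (\<Prod>r\<in>J. w (g r))" for y g
  \<comment> \<open>In \<open>T r\<close> the variable with index a runs over \<open>Y r\<close>
    instead of \<open>Y a\<close>, the others keeping their ranges. The wanted sum is
    \<open>T a\<close>.\<close>
  define T where "T r = (\<Sum>(y, g) \<in> Y r \<times> Pi\<^sub>E J Y. F y g)" for r
  have finU: "finite U" using fin finY by (auto simp: U_def)
  have finP: "finite (Pi\<^sub>E J Y)" using IJ finY by (auto intro!: finite_PiE)
  have "(\<Sum>z\<in>Pi\<^sub>E I Y. vandermonde I z * (\<Prod>r\<in>I. w (z r))) = T a"
  proof -
    have "inj_on (\<lambda>(y, g). g(a := y)) (Y a \<times> Pi\<^sub>E J Y)"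
      using inj_combinator[OF IJ(2), of Y] by (simp add: case_prod_unfold)
    moreover have "(\<Prod>r\<in>I. w ((g(a := y)) r)) = w y * (\<Prod>r\<in>J. w (g r))" for y g
      using IJ by (auto intro!: arg_cong2[of _ _ _ _ "(*)"] prod.cong)
    ultimately show ?thesis
      unfolding T_def IJ(1) PiE_insert_eq
      by (subst sum.reindex) (auto simp: F_def IJ(1)[symmetric] mult_ac case_prod_unfold simp del: fun_upd_apply intro!: sum.cong)
  qed
  moreover have "(\<Sum>r\<in>I. T r) = 0"
  proof -
    have "(\<Sum>r\<in>I. T r) = (\<Sum>r\<in>I. \<Sum>y\<in>Y r. \<Sum>g\<in>Pi\<^sub>E J Y. F y g)"
      by (simp add: T_def sum.cartesian_product)
    also have "\<dots> = (\<Sum>y\<in>U. \<Sum>g\<in>Pi\<^sub>E J Y. F y g)"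
      unfolding U_def using disj finY fin
      by (subst sum.UNION_disjoint) (auto simp: disjoint_family_on_def)
    also have "\<dots> = (\<Sum>g\<in>Pi\<^sub>E J Y. \<Sum>y\<in>U. F y g)" by (rule sum.swap)
    also have "\<dots> = 0"
    proof (rule sum.neutral, rule ballI)
      fix g
      \<comment> \<open>The linear factors \<open>g r - y\<close> are those that
        \<open>vandermonde_remove\<close> splits off; what does not depend on y goes into
        \<open>c\<close>.\<close>
      define P where "P = p * (\<Prod>r\<in>J. [:g r, -1:])"
      define c where "c = (\<Prod>r\<in>J. if r < a then -1 else 1) * vandermonde J g * (\<Prod>r\<in>J. w (g r))"
      have "F y g = c * (poly P y / (\<Prod>u\<in>U-{y}. y - u))" for y
      proof -
        have "vandermonde J (g(a := y)) = vandermonde J g" 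
          using IJ by (intro vandermonde_cong) auto
        moreover have "(\<Prod>r\<in>J. (g(a := y)) r - y) = (\<Prod>r\<in>J. g r - y)" 
          using IJ by (intro prod.cong) auto
        ultimately have "vandermonde I (g(a := y)) =
          (\<Prod>r\<in>J. if r < a then -1 else 1) * (\<Prod>r\<in>J. g r - y) * vandermonde J g"
          using vandermonde_remove[OF fin a, of "g(a := y)"] by (simp add: J_def[symmetric])
        then show ?thesis by (simp add: F_def c_def P_def poly_prod w_def mult_ac)
      qed
      moreover have "degree P \<le> degree p + card J"
      proof -
        have "degree (\<Prod>r\<in>J. [:g r, -1:]) \<le> (\<Sum>r\<in>J. degree [:g r, -1:])"
          using degree_prod_sum_le[OF IJ(3), of "\<lambda>r. [:g r, -1:]"] by (simp only: o_def)
        also have "\<dots> = card J" by simp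
        finally show ?thesis unfolding P_def using degree_mult_le[of p] by (meson add_left_mono le_trans)
      qed
      then have "degree P + 2 \<le> card U"
        using deg IJ by (simp add: U_def)
      ultimately show "(\<Sum>y\<in>U. F y g) = 0"
        using sum_poly_div_nodes_eq_0[OF finU, of P] by (simp only: sum_distrib_left[symmetric] mult_zero_right)
    qed
    finally show ?thesis .
  qed
  moreover have "T r = 0" if r: "r \<in> J" for r
  proof -
    have swap: "F (g r) (g(r := y)) = - F y g" for y g
    proof -
      have "vandermonde I ((g(a := y))(a := (g(a := y)) r, r := (g(a := y)) a)) = - vandermonde I (g(a := y))"
        using IJ r by (intro vandermonde_swap fin) auto
      moreover have "(g(a := y))(a := (g(a := y)) r, r := (g(a := y)) a) = (g(r := y))(a := g r)"
        using IJ r by (auto simp: fun_eq_iff)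
      moreover have "w (g r) * (\<Prod>s\<in>J. w ((g(r := y)) s)) = w y * (\<Prod>s\<in>J. w (g s))"
      proof -
        have "(\<Prod>s\<in>J-{r}. w ((g(r := y)) s)) = (\<Prod>s\<in>J-{r}. w (g s))" by (intro prod.cong) auto
        then show ?thesis using prod.remove[OF IJ(3) r, of "\<lambda>s. w ((g(r := y)) s)"]
          prod.remove[OF IJ(3) r, of "\<lambda>s. w (g s)"] by (simp add: mult_ac)
      qed
      ultimately show ?thesis by (simp add: F_def mult.assoc)
    qed
    \<comment> \<open>For r in J both y and \<open>g r\<close> range over \<open>Y r\<close>, so
      exchanging them is an involution of the index set. It changes the sign of the summand, so
      \<open>T r = - T r\<close>.\<close>
    let ?h = "\<lambda>(y, g). (g r, g(r := y))"
    have h: "?h e \<in> Y r \<times> Pi\<^sub>E J Y \<and> ?h (?h e) = e \<and> (case ?h e of (y, g) \<Rightarrow> - F y g) = (case e of (y, g) \<Rightarrow> F y g)"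
      if "e \<in> Y r \<times> Pi\<^sub>E J Y" for e
    proof -
      obtain y g where e: "e = (y, g)" by (cases e)
      have "g(r := y) \<in> Pi\<^sub>E J Y" "g r \<in> Y r"
        using that r by (auto simp: e PiE_iff extensional_def)
      then show ?thesis using swap[of g y] by (simp add: e)
    qed
    have "T r = (\<Sum>(y, g) \<in> Y r \<times> Pi\<^sub>E J Y. - F y g)"
      unfolding T_def by (rule sum.reindex_bij_witness[where i = ?h and j = ?h]) (use h in blast)+
    also have "\<dots> = - T r" by (simp add: T_def sum_negf case_prod_unfold)
    finally show ?thesis by simp
  qed
  moreover have "sum T I = T a + sum T J" using IJ by simp
  ultimately show ?thesis by (simp add: w_def U_def)
qed

text \<open>As BA = 1, the row E of AB - 1 satisfies EA = 0, because (AB - 1)A = A(BA) - A. At a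
  maximal l in the support of E, triangularity reduces column l of EA to \<open>E l * A l l\<close>,
  and the diagonal entry is nonzero because \<open>B l l * A l l = 1\<close>.\<close>

lemma triangular_left_inverse_imp_right_inverse:
  fixes A B :: "'i::order \<Rightarrow> 'i \<Rightarrow> 'a::field"
  assumes fin: "finite S"
    and A: "\<And>i j. i \<in> S \<Longrightarrow> j \<in> S \<Longrightarrow> \<not> j \<le> i \<Longrightarrow> A i j = 0"
    and B: "\<And>i j. i \<in> S \<Longrightarrow> j \<in> S \<Longrightarrow> \<not> j \<le> i \<Longrightarrow> B i j = 0"
    and BA: "\<And>i j. i \<in> S \<Longrightarrow> j \<in> S \<Longrightarrow> (\<Sum>k\<in>S. B i k * A k j) = of_bool (i = j)"
    and i: "i \<in> S" and j: "j \<in> S"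
  shows "(\<Sum>k\<in>S. A i k * B k j) = of_bool (i = j)"
proof (rule ccontr)
  define E where "E j = (\<Sum>k\<in>S. A i k * B k j) - of_bool (i = j)" for j
  assume "\<not> ?thesis"
  then have "{j\<in>S. E j \<noteq> 0} \<noteq> {}" using j by (auto simp: E_def)
  then obtain l where l: "l \<in> S" "E l \<noteq> 0" and max: "\<And>j. j \<in> S \<Longrightarrow> E j \<noteq> 0 \<Longrightarrow> l \<le> j \<Longrightarrow> l = j"
    using finite_has_maximal[of "{j\<in>S. E j \<noteq> 0}"] fin by auto
  have "(\<Sum>j\<in>S. E j * A j l) = (\<Sum>j\<in>S. \<Sum>k\<in>S. A i k * (B k j * A j l)) - A i l"
    using fin i by (simp add: E_def left_diff_distrib sum_subtractf sum_distrib_right mult.assoc of_bool_def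
      if_distrib[of "\<lambda>t. t * _"] cong: if_cong)
  also have "(\<Sum>j\<in>S. \<Sum>k\<in>S. A i k * (B k j * A j l)) = (\<Sum>k\<in>S. A i k * of_bool (k = l))"
    by (subst sum.swap) (simp add: sum_distrib_left[symmetric] BA l)
  also have "\<dots> = A i l" using fin l by (simp add: of_bool_def
      if_distrib[of "\<lambda>t. _ * t"] cong: if_cong)
  finally have "(\<Sum>j\<in>S. E j * A j l) = 0" by simp
  moreover have "(\<Sum>j\<in>S. E j * A j l) = (\<Sum>j\<in>{l}. E j * A j l)"
    using max A by (intro sum.mono_neutral_right) (use l fin in auto)
  moreover have "(\<Sum>k\<in>S. B l k * A k l) = (\<Sum>k\<in>{l}. B l k * A k l)"
  proof (intro sum.mono_neutral_right ballI)
    fix k assume k: "k \<in> S - {l}"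
    then have "\<not> k \<le> l \<or> \<not> l \<le> k" by auto
    then show "B l k * A k l = 0" using A[of k l] B[of l k] k l by (elim disjE) simp_all
  qed (use l fin in auto)
  then have "A l l \<noteq> 0" using BA[OF l(1) l(1)] by auto
  ultimately show False using l by simp
qed

subsection \<open>Geometric progressions of nodes\<close>

lemma qpoch_add: "qpoch q z (a + b) = qpoch q z a * qpoch q (z * q ^ a) b"
  by (induction b) (simp_all add: qpoch_def power_add mult_ac)

lemma qpoch_Suc: "qpoch q z (Suc k) = qpoch q z k * (1 - z * q ^ k)"
  by (simp add: qpoch_def)

locale q_nodes =
  fixes n :: nat and q :: complex and x :: "nat \<Rightarrow> complex"
  assumes n: "n \<ge> 1" and q0: "q \<noteq> 0"
    and nodes_inj: "\<And>r s i j. r \<in> {1..n} \<Longrightarrow> s \<in> {1..n} \<Longrightarrow> x r * q ^ i = x s * q ^ j \<Longrightarrow> r = s \<and> i = j"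
begin

definition nodal :: "(nat \<Rightarrow> nat) \<Rightarrow> complex \<Rightarrow> complex" where
  "nodal m z = (\<Prod>s=1..n. \<Prod>i<m s. z - x s * q ^ i)"

text \<open>The derivative at the node x_r q^j of the monic polynomial with roots x_s q^i, i \<le>
  M_s. For s = r exactly the vanishing factor is left out.\<close>

definition node_deriv :: "(nat \<Rightarrow> nat) \<Rightarrow> nat \<Rightarrow> nat \<Rightarrow> complex" where
  "node_deriv M r j =
     (\<Prod>s=1..n. \<Prod>i\<in>{..M s} - (if s = r then {j} else {}). x r * q ^ j - x s * q ^ i)"

text \<open>The product of the (q^(-k_s) x_r / x_s)_{m_r} cleared of denominators;
  \<open>den\<close> does the same for (q x_r / x_s)_{m_r}. The product over s is innermost so that
  raising m_r by one adds one complete block, as the recursion in \<open>node_deriv_ratio\<close>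
  requires.\<close>

definition num :: "(nat \<Rightarrow> nat) \<Rightarrow> (nat \<Rightarrow> nat) \<Rightarrow> complex" where
  "num k m = (\<Prod>r=1..n. \<Prod>i<m r. \<Prod>s=1..n. x s * q ^ k s - x r * q ^ i)"

definition den :: "(nat \<Rightarrow> nat) \<Rightarrow> complex" where
  "den m = (\<Prod>r=1..n. \<Prod>i<m r. \<Prod>s=1..n. x s - x r * q ^ Suc i)"

definition vdm :: "(nat \<Rightarrow> nat) \<Rightarrow> complex" where
  "vdm k = vandermonde {1..n} (\<lambda>r. x r * q ^ k r)"

lemma x_nonzero: "r \<in> {1..n} \<Longrightarrow> x r \<noteq> 0"
  using nodes_inj[of r r 0 1] by auto

lemma num_altdef: "num k m = (\<Prod>s=1..n. nodal m (x s * q ^ k s))"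
proof -
  have "num k m = (\<Prod>r=1..n. \<Prod>s=1..n. \<Prod>i<m r. x s * q ^ k s - x r * q ^ i)"
    unfolding num_def by (intro prod.cong refl prod.swap)
  then show ?thesis unfolding nodal_def by (subst prod.swap) simp
qed

lemma den_altdef: "den m = (\<Prod>s=1..n. \<Prod>r=1..n. \<Prod>i<m r. x s - x r * q ^ Suc i)"
proof -
  have "den m = (\<Prod>r=1..n. \<Prod>s=1..n. \<Prod>i<m r. x s - x r * q ^ Suc i)"
    unfolding den_def by (intro prod.cong refl prod.swap)
  then show ?thesis by (subst prod.swap) simp
qed

lemma den_nonzero: "den m \<noteq> 0"
proof -
  have "x s \<noteq> x r * q ^ Suc i" if "r \<in> {1..n}" "s \<in> {1..n}" for r s i
    using nodes_inj[of s r 0 "Suc i"] that by auto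
  then show ?thesis by (simp add: den_def del: power_Suc)
qed

lemma vdm_nonzero: "vdm k \<noteq> 0"
proof -
  have "x s * q ^ k s \<noteq> x r * q ^ k r" if "r \<in> {1..n}" "s \<in> {1..n}" "r < s" for r s
    using nodes_inj[of s r "k s" "k r"] that by auto
  then show ?thesis by (auto simp: vdm_def vandermonde_def)
qed

lemma node_deriv_nonzero:
  assumes "r \<in> {1..n}"
  shows "node_deriv M r j \<noteq> 0"
proof -
  have "x r * q ^ j \<noteq> x s * q ^ i" if "s \<in> {1..n}" "i \<in> {..M s} - (if s = r then {j} else {})" for s i
    using nodes_inj[OF assms(1) that(1), of j i] that(2) by auto
  then show ?thesis unfolding node_deriv_def by simp
qed

text \<open>The factor with i = k_r and s = r vanishes. This is the source both of triangularity and
  of termination.\<close>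

lemma num_eq_0:
  assumes "r \<in> {1..n}" "k r < m r"
  shows "num k m = 0"
proof -
  have "(\<Prod>s=1..n. x s * q ^ k s - x r * q ^ k r) = 0"
    using assms by (auto intro!: bexI[of _ r])
  then have "(\<Prod>i<m r. \<Prod>s=1..n. x s * q ^ k s - x r * q ^ i) = 0"
    using assms by (intro prod_zero) blast+
  then show ?thesis
    unfolding num_def using assms by (intro prod_zero) blast+
qed

text \<open>Multiplication by q shifts every progression by one step: the difference of x_r q^(j+1)
  and x_s q^(i+1) is q times that of x_r q^j and x_s q^i. Only the end nodes x_s and x_s q^(M_s)
  have no partner, and they give the two products over s.\<close>

lemma node_deriv_Suc:
  assumes r: "r \<in> {1..n}" and j: "Suc j \<le> M r"
  shows "(\<Prod>s=1..n. x s * q ^ M s - x r * q ^ j) * q * node_deriv M r (Suc j) =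
    q ^ msize n M * (\<Prod>s=1..n. x s - x r * q ^ Suc j) * node_deriv M r j"
proof -
  have E: "(\<Prod>i\<in>insert 0 (Suc ` E). x r * q ^ Suc j - x s * q ^ i) =
      (x r * q ^ Suc j - x s) * q ^ card E * (\<Prod>i\<in>E. x r * q ^ j - x s * q ^ i)"
    if "finite E" for E s
  proof -
    have "(\<Prod>i\<in>insert 0 (Suc ` E). x r * q ^ Suc j - x s * q ^ i) =
       (x r * q ^ Suc j - x s) * (\<Prod>i\<in>E. x r * q ^ Suc j - x s * q ^ Suc i)"
      using that by (simp add: prod.reindex del: power_Suc)
    also have "(\<Prod>i\<in>E. x r * q ^ Suc j - x s * q ^ Suc i) = (\<Prod>i\<in>E. q * (x r * q ^ j - x s * q ^ i))"
      by (intro prod.cong) (auto simp: algebra_simps)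
    finally show ?thesis by (simp add: prod.distrib mult_ac)
  qed
  define D where "D j s = (\<Prod>i\<in>{..M s} - (if s = r then {j} else {}). x r * q ^ j - x s * q ^ i)" for j s
  have step: "(x s * q ^ M s - x r * q ^ j) * (if s = r then q else 1) * D (Suc j) s =
     q ^ M s * (x s - x r * q ^ Suc j) * D j s" if "s \<in> {1..n}" for s
  proof -
    define E where "E = {..<M s} - (if s = r then {j} else {})"
    have 1: "{..M s} - (if s = r then {Suc j} else {}) = insert 0 (Suc ` E)"
    proof -
      have "{..M s} = insert 0 (Suc ` {..<M s})"
        by (simp add: lessThan_Suc_eq_insert_0 flip: lessThan_Suc_atMost)
      then show ?thesis by (auto simp: E_def)
    qed
    have 2: "{..M s} - (if s = r then {j} else {}) = insert (M s) E"
      using j by (auto simp: E_def)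
    \<comment> \<open>For s = r one node is left out, so one power of q is missing; this is the
      isolated factor q of the statement.\<close>
    have c: "card E + (if s = r then 1 else 0) = M s"
      using j by (auto simp: E_def card_Diff_singleton)
    have pw: "q ^ card E * (if s = r then q else 1) = q ^ M s"
      unfolding c[symmetric] by (simp add: power_add)
    have d1: "D (Suc j) s = (x r * q ^ Suc j - x s) * q ^ card E * (\<Prod>i\<in>E. x r * q ^ j - x s * q ^ i)"
      unfolding D_def 1 by (rule E) (simp add: E_def)
    have d2: "D j s = (x r * q ^ j - x s * q ^ M s) * (\<Prod>i\<in>E. x r * q ^ j - x s * q ^ i)"
      unfolding D_def 2 by (subst prod.insert) (auto simp: E_def)
    have "u * e * (v * c * p) = c * e * (- v) * (- u * p)" for u e v c p :: complex
      by (simp add: mult_ac)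
    from this[of "x s * q ^ M s - x r * q ^ j"] show ?thesis
      unfolding d1 d2 by (simp only: minus_diff_eq pw)
  qed
  have "(\<Prod>s=1..n. (x s * q ^ M s - x r * q ^ j) * (if s = r then q else 1) * D (Suc j) s) =
    (\<Prod>s=1..n. q ^ M s * (x s - x r * q ^ Suc j) * D j s)"
    by (rule prod.cong[OF refl step])
  moreover have "(\<Prod>s=1..n. if s = r then q else 1) = q" using r by simp
  ultimately show ?thesis
    by (simp only: prod.distrib node_deriv_def D_def msize_def power_sum)
qed

lemma node_deriv_ratio:
  assumes r: "r \<in> {1..n}" and "j \<le> M r"
  shows "q ^ j * (\<Prod>i<j. \<Prod>s=1..n. x s * q ^ M s - x r * q ^ i) * node_deriv M r j =
    q ^ (msize n M * j) * (\<Prod>i<j. \<Prod>s=1..n. x s - x r * q ^ Suc i) * node_deriv M r 0"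
  using assms(2)
proof (induction j)
  case (Suc j)
  let ?N = "\<lambda>j. \<Prod>i<j. \<Prod>s=1..n. x s * q ^ M s - x r * q ^ i"
  let ?D = "\<lambda>j. \<Prod>i<j. \<Prod>s=1..n. x s - x r * q ^ Suc i"
  have "q ^ Suc j * ?N (Suc j) * node_deriv M r (Suc j) =
     q ^ j * ?N j * ((\<Prod>s=1..n. x s * q ^ M s - x r * q ^ j) * q * node_deriv M r (Suc j))"
    by (simp add: mult_ac)
  also have "\<dots> = q ^ msize n M * (\<Prod>s=1..n. x s - x r * q ^ Suc j) * (q ^ j * ?N j * node_deriv M r j)"
    unfolding node_deriv_Suc[where M = M, OF r Suc.prems] by (simp only: mult_ac)
  also have "\<dots> = q ^ msize n M * (\<Prod>s=1..n. x s - x r * q ^ Suc j) * (q ^ (msize n M * j) * ?D j * node_deriv M r 0)"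
    using Suc by simp
  also have "\<dots> = q ^ (msize n M * Suc j) * ?D (Suc j) * node_deriv M r 0"
    by (simp add: power_add mult_ac)
  finally show ?case .
qed simp

text \<open>This turns the coefficients of the inner sum into the interpolation weights
  1/\<omega>'(x_r q^(k_r)), up to a constant depending on M only.\<close>

lemma num_div_den:
  assumes "\<And>r. r \<in> {1..n} \<Longrightarrow> k r \<le> M r"
  shows "q ^ msize n k * num M k / (q ^ (msize n M * msize n k) * den k) =
    (\<Prod>r=1..n. node_deriv M r 0 / node_deriv M r (k r))"
proof -
  have "(\<Prod>r=1..n. q ^ k r * (\<Prod>i<k r. \<Prod>s=1..n. x s * q ^ M s - x r * q ^ i) * node_deriv M r (k r)) =
    (\<Prod>r=1..n. q ^ (msize n M * k r) * (\<Prod>i<k r. \<Prod>s=1..n. x s - x r * q ^ Suc i) * node_deriv M r 0)"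
    by (intro prod.cong refl node_deriv_ratio assms)
  then have "q ^ msize n k * num M k * (\<Prod>r=1..n. node_deriv M r (k r)) =
    q ^ (msize n M * msize n k) * den k * (\<Prod>r=1..n. node_deriv M r 0)"
    by (simp only: prod.distrib num_def den_def power_sum[symmetric] msize_def sum_distrib_left)
  moreover have "(\<Prod>r=1..n. node_deriv M r (k r)) \<noteq> 0"
    using assms node_deriv_nonzero by simp
  ultimately show ?thesis
    using den_nonzero q0 by (simp add: prod_dividef field_simps)
qed

text \<open>Needed for the diagonal of the matrix product, to which both matrices contribute a
  Vandermonde product and a \<open>num\<close> / \<open>den\<close> quotient, hence the squares. It
  is \<open>node_deriv_ratio\<close> at j = m_r: the derivatives at the last nodes contain all
  differences of last nodes and \<open>num m m\<close>, those at the first nodes all differences of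
  first nodes and \<open>den m\<close>. The sign \<sigma> is common to both and cancels.\<close>

lemma num_diagonal:
  "q ^ msize n m * (vdm m * num m m)\<^sup>2 = q ^ (msize n m * msize n m) * (vdm (\<lambda>_. 0) * den m)\<^sup>2"
proof -
  let ?I = "{1..n}"
  define \<sigma> where "\<sigma> = (\<Prod>s\<in>?I. \<Prod>r\<in>{r\<in>?I. s < r}. - 1 :: complex)"
  have \<sigma>: "\<sigma> \<noteq> 0" by (simp add: \<sigma>_def)
  have split: "(\<Prod>s\<in>?I. if s = r then 1 else f s) = (\<Prod>s\<in>?I-{r}. f s)" for r and f :: "nat \<Rightarrow> complex"
    by (intro prod.mono_neutral_cong_right) auto
  have top: "node_deriv m r (m r) = (\<Prod>s\<in>?I-{r}. x r * q ^ m r - x s * q ^ m s) * nodal m (x r * q ^ m r)"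
    if r: "r \<in> ?I" for r
  proof -
    have "node_deriv m r (m r) =
      (\<Prod>s\<in>?I. (if s = r then 1 else x r * q ^ m r - x s * q ^ m s) * (\<Prod>i<m s. x r * q ^ m r - x s * q ^ i))"
      unfolding node_deriv_def
    proof (intro prod.cong refl)
      fix s
      have "{..m s} - {m s} = {..<m s}" "{..m s} = insert (m s) {..<m s}" by auto
      then show "(\<Prod>i\<in>{..m s} - (if s = r then {m r} else {}). x r * q ^ m r - x s * q ^ i) =
         (if s = r then 1 else x r * q ^ m r - x s * q ^ m s) * (\<Prod>i<m s. x r * q ^ m r - x s * q ^ i)"
        by auto
    qed
    then show ?thesis by (simp only: prod.distrib split nodal_def)
  qed
  have bot: "node_deriv m r 0 = (\<Prod>s\<in>?I-{r}. x r - x s) * (\<Prod>s\<in>?I. \<Prod>i<m s. x r - x s * q ^ Suc i)"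
    if r: "r \<in> ?I" for r
  proof -
    have "node_deriv m r 0 =
      (\<Prod>s\<in>?I. (if s = r then 1 else x r - x s) * (\<Prod>i<m s. x r - x s * q ^ Suc i))"
      unfolding node_deriv_def
    proof (intro prod.cong refl)
      fix s
      have "(\<Prod>i\<in>{..m s} - {0}. x r - x s * q ^ i) = (\<Prod>i<m s. x r - x s * q ^ Suc i)"
        by (rule prod.reindex_bij_witness[of _ Suc "\<lambda>i. i - 1"]) auto
      moreover have "(\<Prod>i\<in>{..m s}. x r - x s * q ^ i) = (x r - x s) * (\<Prod>i<m s. x r - x s * q ^ Suc i)"
        by (simp only: prod.atMost_shift power_0 mult_1_right)
      ultimately show "(\<Prod>i\<in>{..m s} - (if s = r then {0} else {}). x r * q ^ 0 - x s * q ^ i) =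
         (if s = r then 1 else x r - x s) * (\<Prod>i<m s. x r - x s * q ^ Suc i)"
        by (cases "s = r") (simp_all del: power_Suc)
    qed
    then show ?thesis by (simp only: prod.distrib split)
  qed
  have "(\<Prod>r\<in>?I. node_deriv m r (m r)) = \<sigma> * (vdm m)\<^sup>2 * num m m"
    using prod_differences_eq_vandermonde_square[of ?I "\<lambda>r. x r * q ^ m r"]
    by (simp add: top prod.distrib num_altdef vdm_def \<sigma>_def)
  moreover have "(\<Prod>r\<in>?I. node_deriv m r 0) = \<sigma> * (vdm (\<lambda>_. 0))\<^sup>2 * den m"
    using prod_differences_eq_vandermonde_square[of ?I x]
    by (simp add: bot prod.distrib den_altdef vdm_def \<sigma>_def del: power_Suc)
  moreover have "(\<Prod>r\<in>?I. q ^ m r * (\<Prod>i<m r. \<Prod>s=1..n. x s * q ^ m s - x r * q ^ i) * node_deriv m r (m r)) =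
    (\<Prod>r\<in>?I. q ^ (msize n m * m r) * (\<Prod>i<m r. \<Prod>s=1..n. x s - x r * q ^ Suc i) * node_deriv m r 0)"
    by (intro prod.cong refl node_deriv_ratio) simp_all
  then have "q ^ msize n m * num m m * (\<Prod>r\<in>?I. node_deriv m r (m r)) =
    q ^ (msize n m * msize n m) * den m * (\<Prod>r\<in>?I. node_deriv m r 0)"
    by (simp only: prod.distrib num_def den_def power_sum[symmetric] msize_def sum_distrib_left)
  ultimately have "\<sigma> * (q ^ msize n m * (vdm m * num m m)\<^sup>2) =
     \<sigma> * (q ^ (msize n m * msize n m) * (vdm (\<lambda>_. 0) * den m)\<^sup>2)"
    by (simp add: power2_eq_square mult_ac)
  then show ?thesis using \<sigma> by simp
qed

text \<open>There are |M| + n nodes in n disjoint progressions, so the n in the general degree bound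
  cancels.\<close>

lemma sum_vdm_node_deriv_eq_0:
  assumes deg: "degree p < msize n M"
  shows "(\<Sum>k\<in>(\<Pi>\<^sub>E r\<in>{1..n}. {..M r}).
    vdm k * (\<Prod>r=1..n. poly p (x r * q ^ k r) / node_deriv M r (k r))) = 0"
proof -
  let ?I = "{1..n}"
  define Y where "Y r = (\<lambda>i. x r * q ^ i) ` {..M r}" for r
  have inj: "inj_on (\<lambda>(s, i). x s * q ^ i) (?I \<times> UNIV)"
    using nodes_inj by (force simp: inj_on_def)
  have U: "(\<Union>r\<in>?I. Y r) = (\<lambda>(s, i). x s * q ^ i) ` (SIGMA s:?I. {..M s})"
    by (auto simp: Y_def)
  have "card (\<Union>r\<in>?I. Y r) = card (SIGMA s:?I. {..M s})"
    unfolding U by (intro card_image inj_on_subset[OF inj]) auto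
  also have "\<dots> = msize n M + n" by (simp add: msize_def sum_Suc)
  finally have cardU: "card (\<Union>r\<in>?I. Y r) = msize n M + n" .
  have disj: "disjoint_family_on Y ?I"
    unfolding disjoint_family_on_def Y_def using nodes_inj by blast
  \<comment> \<open>A product over a set of nodes becomes one over pairs (s, i); distinctness of the
    nodes ensures that no factors are merged.\<close>
  have nd: "(\<Prod>u\<in>(\<Union>r\<in>?I. Y r) - {x r * q ^ j}. x r * q ^ j - u) = node_deriv M r j"
    if r: "r \<in> ?I" and j: "j \<le> M r" for r j
  proof -
    let ?E = "\<lambda>s. {..M s} - (if s = r then {j} else {})"
    have eq: "(\<Union>r\<in>?I. Y r) - {x r * q ^ j} = (\<lambda>(s, i). x s * q ^ i) ` (SIGMA s:?I. ?E s)"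
    proof (intro equalityI subsetI)
      fix u assume "u \<in> (\<Union>r\<in>?I. Y r) - {x r * q ^ j}"
      then obtain s i where "s \<in> ?I" "i \<le> M s" "u = x s * q ^ i" "x s * q ^ i \<noteq> x r * q ^ j"
        by (auto simp: Y_def)
      then show "u \<in> (\<lambda>(s, i). x s * q ^ i) ` (SIGMA s:?I. ?E s)"
        by (intro image_eqI[of _ _ "(s, i)"]) auto
    next
      fix u assume "u \<in> (\<lambda>(s, i). x s * q ^ i) ` (SIGMA s:?I. ?E s)"
      then obtain s i where s: "s \<in> ?I" "i \<le> M s" "\<not> (s = r \<and> i = j)" and u: "u = x s * q ^ i"
        by (auto split: if_splits)
      then have "u \<noteq> x r * q ^ j" using nodes_inj[OF s(1) r, of i j] by auto
      then show "u \<in> (\<Union>r\<in>?I. Y r) - {x r * q ^ j}" using s u by (auto simp: Y_def)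
    qed
    have "(\<Prod>u\<in>(\<Union>r\<in>?I. Y r) - {x r * q ^ j}. x r * q ^ j - u) =
       (\<Prod>(s, i)\<in>(SIGMA s:?I. ?E s). x r * q ^ j - x s * q ^ i)"
      unfolding eq by (subst prod.reindex) (auto intro!: inj_on_subset[OF inj] prod.cong)
    also have "\<dots> = node_deriv M r j"
      unfolding node_deriv_def by (subst prod.Sigma) auto
    finally show ?thesis .
  qed
  have image: "Pi\<^sub>E ?I Y = (\<lambda>k. \<lambda>r\<in>?I. x r * q ^ k r) ` (\<Pi>\<^sub>E r\<in>?I. {..M r})"
  proof (intro equalityI subsetI)
    fix z assume z: "z \<in> Pi\<^sub>E ?I Y"
    then have "\<forall>r\<in>?I. \<exists>i\<le>M r. z r = x r * q ^ i"
      by (auto simp: Y_def PiE_iff image_iff Bex_def)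
    then obtain k where "\<forall>r\<in>?I. k r \<le> M r \<and> z r = x r * q ^ k r" by metis
    then have "z = (\<lambda>r\<in>?I. x r * q ^ (restrict k ?I) r)" "restrict k ?I \<in> (\<Pi>\<^sub>E r\<in>?I. {..M r})"
      using z by (auto simp: PiE_iff extensional_def fun_eq_iff)
    then show "z \<in> (\<lambda>k. \<lambda>r\<in>?I. x r * q ^ k r) ` (\<Pi>\<^sub>E r\<in>?I. {..M r})" by blast
  qed (auto simp: Y_def PiE_iff)
  have "0 = (\<Sum>z\<in>Pi\<^sub>E ?I Y. vandermonde ?I z *
    (\<Prod>r\<in>?I. poly p (z r) / (\<Prod>u\<in>(\<Union>r\<in>?I. Y r)-{z r}. z r - u)))"
    using n deg cardU by (intro sum_vandermonde_nodes_eq_0[symmetric] disj) (auto simp: Y_def)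
  also have "\<dots> =
    (\<Sum>k\<in>(\<Pi>\<^sub>E r\<in>?I. {..M r}). vandermonde ?I (\<lambda>r\<in>?I. x r * q ^ k r) *
      (\<Prod>r\<in>?I. poly p (x r * q ^ k r) / (\<Prod>u\<in>(\<Union>r\<in>?I. Y r)-{x r * q ^ k r}. x r * q ^ k r - u)))"
    unfolding image
  proof (subst sum.reindex)
    show "inj_on (\<lambda>k. \<lambda>r\<in>?I. x r * q ^ k r) (\<Pi>\<^sub>E r\<in>?I. {..M r})"
    proof (rule inj_onI)
      fix k k' assume k: "k \<in> (\<Pi>\<^sub>E r\<in>?I. {..M r})" "k' \<in> (\<Pi>\<^sub>E r\<in>?I. {..M r})"
        and eq: "(\<lambda>r\<in>?I. x r * q ^ k r) = (\<lambda>r\<in>?I. x r * q ^ k' r)"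
      show "k = k'"
      proof (rule PiE_ext[OF k])
        fix r assume r: "r \<in> ?I"
        then have "x r * q ^ k r = x r * q ^ k' r" using fun_cong[OF eq, of r] by simp
        then show "k r = k' r" using nodes_inj[OF r r] by blast
      qed
    qed
  qed (auto intro!: sum.cong prod.cong)
  also have "\<dots> = (\<Sum>k\<in>(\<Pi>\<^sub>E r\<in>?I. {..M r}).
      vdm k * (\<Prod>r\<in>?I. poly p (x r * q ^ k r) / node_deriv M r (k r)))"
    unfolding vdm_def
  proof (intro sum.cong refl arg_cong2[of _ _ _ _ "(*)"] prod.cong vandermonde_cong)
    fix k r assume "k \<in> (\<Pi>\<^sub>E r\<in>?I. {..M r})" "r \<in> ?I"
    then have "(\<Prod>u\<in>(\<Union>r\<in>?I. Y r)-{x r * q ^ k r}. x r * q ^ k r - u) = node_deriv M r (k r)"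
      by (intro nd) auto
    then show "poly p (x r * q ^ k r) / (\<Prod>u\<in>(\<Union>r\<in>?I. Y r)-{x r * q ^ k r}. x r * q ^ k r - u) =
        poly p (x r * q ^ k r) / node_deriv M r (k r)"
      by (rule arg_cong)
  qed auto
  finally show ?thesis by simp
qed

end

subsection \<open>The inverse pair of matrices\<close>

context q_nodes begin

text \<open>Coefficients of the outer series for a_r = q^(k_r + 1), divided by the product of the
  (\<alpha> q x_r)_{k_r}. The normalisation merges the denominators into (\<alpha> x_r)_{k_r + |m| +
  1}, where k and m occur only in a sum.\<close>

definition Amat :: "complex \<Rightarrow> (nat \<Rightarrow> nat) \<Rightarrow> (nat \<Rightarrow> nat) \<Rightarrow> complex" where
  "Amat \<alpha> k m = vdm m / vdm (\<lambda>_. 0) * (num k m / den m) *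
     (\<Prod>r=1..n. (1 - \<alpha> * x r * q ^ (m r + msize n m)) * qpoch q (\<alpha> * x r) (msize n m) /
        qpoch q (\<alpha> * x r) (Suc (k r + msize n m)))"

text \<open>Coefficients of the inner sum, stripped of the factors with b and of the values of f.
  They are polynomial in \<alpha>.\<close>

definition Bmat :: "complex \<Rightarrow> (nat \<Rightarrow> nat) \<Rightarrow> (nat \<Rightarrow> nat) \<Rightarrow> complex" where
  "Bmat \<alpha> M k = q ^ msize n k * (vdm k / vdm (\<lambda>_. 0)) * (num M k / den k) / q ^ (msize n M * msize n k) *
     (\<Prod>r=1..n. qpoch q (\<alpha> * x r * q ^ msize n M) (k r))"

definition generic :: "complex \<Rightarrow> bool" where
  "generic \<alpha> \<longleftrightarrow> (\<forall>r\<in>{1..n}. \<forall>i. \<alpha> * x r * q ^ i \<noteq> 1)"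

lemma qpoch_generic: "generic \<alpha> \<Longrightarrow> r \<in> {1..n} \<Longrightarrow> qpoch q (\<alpha> * x r) k \<noteq> 0"
  by (auto simp: generic_def qpoch_def)

lemma not_le_imp_num_eq_0:
  assumes "k \<in> (\<Pi>\<^sub>E r\<in>{1..n}. K r)" "m \<in> (\<Pi>\<^sub>E r\<in>{1..n}. L r)" "\<not> m \<le> k"
  shows "num k m = 0"
proof -
  obtain r where "\<not> m r \<le> k r" using assms(3) by (auto simp: le_fun_def)
  moreover from this have "r \<in> {1..n}" using assms(1,2) by (cases "r \<in> {1..n}") (auto simp: PiE_iff extensional_def)
  ultimately show ?thesis by (intro num_eq_0[of r]) auto
qed

text \<open>If |m| < |M|, the Pochhammer factors containing k_r combine to a polynomial in x_r
  q^(k_r) of degree at most |M| - |m| - 1, and \<open>num\<close> contributes degree |m|; the total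
  stays just below |M|. Otherwise m \<le> k \<le> M leaves only M = k = m.\<close>

lemma sum_Bmat_Amat:
  assumes gen: "generic \<alpha>"
    and S: "S = (\<Pi>\<^sub>E r\<in>{1..n}. {..N r})" and M: "M \<in> S" and m: "m \<in> S"
  shows "(\<Sum>k\<in>S. Bmat \<alpha> M k * Amat \<alpha> k m) = of_bool (M = m)"
proof (cases "msize n m < msize n M")
  case True
  define d where "d = msize n M - msize n m - 1"
  have d: "msize n M = Suc (msize n m + d)" using True by (simp add: d_def)
  define P where "P = (\<Prod>s=1..n. \<Prod>i<m s. [:- (x s * q ^ i), 1:]) *
    (\<Prod>i<d. [:1, - (\<alpha> * q ^ Suc (msize n m) * q ^ i):])"
  have P: "poly P z = nodal m z * qpoch q (\<alpha> * z * q ^ Suc (msize n m)) d" for z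
    by (simp add: P_def poly_prod nodal_def qpoch_def mult_ac)
  have "degree P \<le> msize n m + d"
  proof -
    have "degree (\<Prod>s=1..n. \<Prod>i<m s. [:- (x s * q ^ i), 1:]) = msize n m"
      by (subst degree_prod_eq_sum_degree) (simp_all add: msize_def degree_prod_eq_sum_degree)
    moreover have "degree (\<Prod>i<d. [:1, - (\<alpha> * q ^ Suc (msize n m) * q ^ i):]) \<le> (\<Sum>i<d. 1)"
    proof (rule order_trans[OF degree_prod_sum_le])
      show "sum (degree \<circ> (\<lambda>i. [:1, - (\<alpha> * q ^ Suc (msize n m) * q ^ i):])) {..<d} \<le> (\<Sum>i<d. 1)"
        unfolding o_def by (rule sum_mono) (rule order_trans[OF degree_pCons_le], simp)
    qed simp
    ultimately show ?thesis
      unfolding P_def by (intro order_trans[OF degree_mult_le] add_mono) simp_all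
  qed
  then have "degree P < msize n M" using d by simp
  then have zero: "(\<Sum>k\<in>(\<Pi>\<^sub>E r\<in>{1..n}. {..M r}).
      vdm k * (\<Prod>r=1..n. poly P (x r * q ^ k r) / node_deriv M r (k r))) = 0"
    by (rule sum_vdm_node_deriv_eq_0)
  define C where "C = vdm m / (vdm (\<lambda>_. 0))\<^sup>2 / den m * (\<Prod>r=1..n. node_deriv M r 0) *
    (\<Prod>r=1..n. (1 - \<alpha> * x r * q ^ (m r + msize n m)) * qpoch q (\<alpha> * x r) (msize n m) /
       qpoch q (\<alpha> * x r) (msize n M))"
  \<comment> \<open>The nodes are determined by M, so the sum over the fixed box S is first cut down
    to k \<le> M.\<close>
  have "(\<Sum>k\<in>S. Bmat \<alpha> M k * Amat \<alpha> k m) =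
      (\<Sum>k\<in>(\<Pi>\<^sub>E r\<in>{1..n}. {..M r}). Bmat \<alpha> M k * Amat \<alpha> k m)"
  proof (rule sum.mono_neutral_right)
    show "(\<Pi>\<^sub>E r\<in>{1..n}. {..M r}) \<subseteq> S" using M unfolding S
      by (intro PiE_mono) (auto simp: PiE_iff)
    show "\<forall>k\<in>S - (\<Pi>\<^sub>E r\<in>{1..n}. {..M r}). Bmat \<alpha> M k * Amat \<alpha> k m = 0"
    proof
      fix k assume k: "k \<in> S - (\<Pi>\<^sub>E r\<in>{1..n}. {..M r})"
      then have "\<not> k \<le> M" unfolding S by (auto simp: PiE_iff le_fun_def)
      then have "num M k = 0" using M k unfolding S by (intro not_le_imp_num_eq_0) auto
      then show "Bmat \<alpha> M k * Amat \<alpha> k m = 0" by (simp add: Bmat_def)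
    qed
  qed (auto simp: S intro!: finite_PiE)
  also have "\<dots> = (\<Sum>k\<in>(\<Pi>\<^sub>E r\<in>{1..n}. {..M r}).
      C * (vdm k * (\<Prod>r=1..n. poly P (x r * q ^ k r) / node_deriv M r (k r))))"
  proof (intro sum.cong refl)
    fix k assume "k \<in> (\<Pi>\<^sub>E r\<in>{1..n}. {..M r})"
    then have k: "k r \<le> M r" if "r \<in> {1..n}" for r using that by auto
    have "(\<Prod>r=1..n. qpoch q (\<alpha> * x r * q ^ msize n M) (k r)) *
       (\<Prod>r=1..n. (1 - \<alpha> * x r * q ^ (m r + msize n m)) * qpoch q (\<alpha> * x r) (msize n m) /
         qpoch q (\<alpha> * x r) (Suc (k r + msize n m))) =
       (\<Prod>r=1..n. (1 - \<alpha> * x r * q ^ (m r + msize n m)) * qpoch q (\<alpha> * x r) (msize n m) /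
         qpoch q (\<alpha> * x r) (msize n M)) *
       (\<Prod>r=1..n. qpoch q (\<alpha> * (x r * q ^ k r) * q ^ Suc (msize n m)) d)"
      unfolding prod.distrib[symmetric]
    proof (intro prod.cong refl)
      fix r assume r: "r \<in> {1..n}"
      \<comment> \<open>Splitting (\<alpha> x_r)_{|M| + k_r} at |M| and at k_r + |m| + 1 trades the
        quotient in k_r for a polynomial in x_r q^(k_r).\<close>
      have "qpoch q (\<alpha> * x r) (msize n M) * qpoch q (\<alpha> * x r * q ^ msize n M) (k r) =
        qpoch q (\<alpha> * x r) (msize n M + k r)" by (simp add: qpoch_add)
      also have "msize n M + k r = Suc (k r + msize n m) + d" by (simp add: d)
      also have "qpoch q (\<alpha> * x r) \<dots> = qpoch q (\<alpha> * x r) (Suc (k r + msize n m)) *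
          qpoch q (\<alpha> * (x r * q ^ k r) * q ^ Suc (msize n m)) d"
        unfolding qpoch_add by (simp add: power_add mult_ac)
      finally show "qpoch q (\<alpha> * x r * q ^ msize n M) (k r) *
          ((1 - \<alpha> * x r * q ^ (m r + msize n m)) * qpoch q (\<alpha> * x r) (msize n m) /
         qpoch q (\<alpha> * x r) (Suc (k r + msize n m))) =
         (1 - \<alpha> * x r * q ^ (m r + msize n m)) * qpoch q (\<alpha> * x r) (msize n m) /
         qpoch q (\<alpha> * x r) (msize n M) * qpoch q (\<alpha> * (x r * q ^ k r) * q ^ Suc (msize n m)) d"
        using qpoch_generic[OF gen r, of "msize n M"] qpoch_generic[OF gen r, of "Suc (k r + msize n m)"]
        by (simp add: divide_simps) (simp add: mult_ac)
    qed
    then have eq: "p * (\<Prod>r=1..n. qpoch q (\<alpha> * x r * q ^ msize n M) (k r)) *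
       (\<Prod>r=1..n. (1 - \<alpha> * x r * q ^ (m r + msize n m)) * qpoch q (\<alpha> * x r) (msize n m) /
         qpoch q (\<alpha> * x r) (Suc (k r + msize n m))) =
       p * ((\<Prod>r=1..n. (1 - \<alpha> * x r * q ^ (m r + msize n m)) * qpoch q (\<alpha> * x r) (msize n m) /
         qpoch q (\<alpha> * x r) (msize n M)) *
       (\<Prod>r=1..n. qpoch q (\<alpha> * (x r * q ^ k r) * q ^ Suc (msize n m)) d))" for p
      by (simp only: mult.assoc)
    have "Bmat \<alpha> M k * Amat \<alpha> k m =
       (q ^ msize n k * num M k / (q ^ (msize n M * msize n k) * den k)) *
       (vdm k * vdm m / (vdm (\<lambda>_. 0))\<^sup>2 / den m * num k m) *
       (\<Prod>r=1..n. qpoch q (\<alpha> * x r * q ^ msize n M) (k r)) *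
       (\<Prod>r=1..n. (1 - \<alpha> * x r * q ^ (m r + msize n m)) * qpoch q (\<alpha> * x r) (msize n m) /
         qpoch q (\<alpha> * x r) (Suc (k r + msize n m)))"
      by (simp add: Bmat_def Amat_def power2_eq_square mult_ac)
    also have "\<dots> = C * (vdm k * (num k m * (\<Prod>r=1..n. qpoch q (\<alpha> * (x r * q ^ k r) * q ^ Suc (msize n m)) d) /
         (\<Prod>r=1..n. node_deriv M r (k r))))"
      unfolding eq by (subst num_div_den) (simp_all add: k C_def prod_dividef mult_ac)
    finally show "Bmat \<alpha> M k * Amat \<alpha> k m =
        C * (vdm k * (\<Prod>r=1..n. poly P (x r * q ^ k r) / node_deriv M r (k r)))"
      by (simp only: prod_dividef P prod.distrib num_altdef)
  qed
  also have "\<dots> = 0" unfolding sum_distrib_left[symmetric] zero by simp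
  finally show ?thesis using True by auto
next
  case False
  have sum: "(\<Sum>k\<in>S. Bmat \<alpha> M k * Amat \<alpha> k m) =
      (\<Sum>k\<in>{m}. if M = m then Bmat \<alpha> m m * Amat \<alpha> m m else 0)"
  proof (rule sum.mono_neutral_cong_right)
    have *: "M = m \<and> k = m" if k: "k \<in> S" and nz: "Bmat \<alpha> M k * Amat \<alpha> k m \<noteq> 0" for k
    proof -
      have "num M k \<noteq> 0" "num k m \<noteq> 0" using nz by (auto simp: Bmat_def Amat_def)
      then have le: "k \<le> M" "m \<le> k" using not_le_imp_num_eq_0 M m k unfolding S by blast+
      \<comment> \<open>Since m \<le> M, one strict component would give |m| < |M|.\<close>
      then have "\<not> m r < M r" if "r \<in> {1..n}" for r
        using False that le unfolding msize_def le_fun_def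
        by (metis sum_strict_mono_ex1 finite_atLeastAtMost order_trans)
      then have "M r \<le> m r" if "r \<in> {1..n}" for r using that by force
      then have "k r = m r" "M r = m r" if "r \<in> {1..n}" for r
        using le that by (meson antisym le_funD order_trans)+
      then show ?thesis using M m k unfolding S by (blast intro: PiE_ext)
    qed
    show "\<forall>k\<in>S - {m}. Bmat \<alpha> M k * Amat \<alpha> k m = 0" using * by blast
    show "Bmat \<alpha> M k * Amat \<alpha> k m = (if M = m then Bmat \<alpha> m m * Amat \<alpha> m m else 0)" if "k \<in> {m}" for k
      using *[OF m] that by auto
  qed (use m in \<open>auto simp: S intro!: finite_PiE\<close>)
  have "Bmat \<alpha> m m * Amat \<alpha> m m = 1"
  proof -
    have "(\<Prod>r=1..n. qpoch q (\<alpha> * x r * q ^ msize n m) (m r)) *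
      (\<Prod>r=1..n. (1 - \<alpha> * x r * q ^ (m r + msize n m)) * qpoch q (\<alpha> * x r) (msize n m) /
         qpoch q (\<alpha> * x r) (Suc (m r + msize n m))) = (\<Prod>r=1..n. 1)"
      unfolding prod.distrib[symmetric]
    proof (intro prod.cong refl)
      fix r assume r: "r \<in> {1..n}"
      have "qpoch q (\<alpha> * x r) (Suc (m r + msize n m)) = 
         (1 - \<alpha> * x r * q ^ (m r + msize n m)) * (qpoch q (\<alpha> * x r) (msize n m) * qpoch q (\<alpha> * x r * q ^ msize n m) (m r))"
        unfolding qpoch_Suc add.commute[of "m r"] qpoch_add by (simp only: mult_ac)
      then show "qpoch q (\<alpha> * x r * q ^ msize n m) (m r) *
         ((1 - \<alpha> * x r * q ^ (m r + msize n m)) * qpoch q (\<alpha> * x r) (msize n m) /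
         qpoch q (\<alpha> * x r) (Suc (m r + msize n m))) = 1"
        using qpoch_generic[OF gen r, of "Suc (m r + msize n m)"] by (simp add: mult_ac)
    qed
    then have "Bmat \<alpha> m m * Amat \<alpha> m m =
      q ^ msize n m * (vdm m * num m m)\<^sup>2 / (q ^ (msize n m * msize n m) * (vdm (\<lambda>_. 0) * den m)\<^sup>2)"
      by (simp add: Bmat_def Amat_def power2_eq_square mult_ac)
    then show ?thesis
      using num_diagonal[of m] den_nonzero vdm_nonzero q0 by simp
  qed
  then show ?thesis using sum by simp
qed

lemma sum_Amat_Bmat:
  assumes gen: "generic \<alpha>"
    and S: "S = (\<Pi>\<^sub>E r\<in>{1..n}. {..N r})" and M: "M \<in> S" and m: "m \<in> S"
  shows "(\<Sum>k\<in>S. Amat \<alpha> M k * Bmat \<alpha> k m) = of_bool (M = m)"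
proof (rule triangular_left_inverse_imp_right_inverse[OF _ _ _ sum_Bmat_Amat[OF gen S] M m])
  show "finite S" by (auto simp: S intro!: finite_PiE)
  show "Amat \<alpha> i j = 0" "Bmat \<alpha> i j = 0" if "i \<in> S" "j \<in> S" "\<not> j \<le> i" for i j
    using not_le_imp_num_eq_0[of i _ j] that unfolding S by (auto simp: Amat_def Bmat_def)
qed

text \<open>For the remaining \<open>\<alpha>\<close> the matrix \<open>Amat\<close> has no meaning, but after multiplication by
  \<open>\<Prod>\<^sub>r qpoch q (\<alpha> q x\<^sub>r) (M r)\<close> the row \<open>M\<close> is continuous there.\<close>

definition Arow :: "complex \<Rightarrow> (nat \<Rightarrow> nat) \<Rightarrow> (nat \<Rightarrow> nat) \<Rightarrow> complex" where
  "Arow \<alpha> M k = vdm k / vdm (\<lambda>_. 0) * (num M k / den k) *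
     (\<Prod>r=1..n. (1 - \<alpha> * x r * q ^ (k r + msize n k)) / (1 - \<alpha> * x r)) *
     (\<Prod>r=1..n. qpoch q (\<alpha> * x r) (msize n k) / qpoch q (\<alpha> * x r * q ^ Suc (M r)) (msize n k))"

lemma Arow_generic:
  assumes gen: "generic \<alpha>"
  shows "Arow \<alpha> M k = (\<Prod>r=1..n. qpoch q (\<alpha> * q * x r) (M r)) * Amat \<alpha> M k"
proof -
  have "(1 - \<alpha> * x r * q ^ (k r + msize n k)) / (1 - \<alpha> * x r) *
      (qpoch q (\<alpha> * x r) (msize n k) / qpoch q (\<alpha> * x r * q ^ Suc (M r)) (msize n k)) =
    qpoch q (\<alpha> * q * x r) (M r) * ((1 - \<alpha> * x r * q ^ (k r + msize n k)) * qpoch q (\<alpha> * x r) (msize n k) /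
        qpoch q (\<alpha> * x r) (Suc (M r + msize n k)))" if r: "r \<in> {1..n}" for r
  proof -
    \<comment> \<open>The middle factor is the only one that may vanish under the hypotheses of the
      identity, and it is the one that \<open>Arow\<close> multiplies away.\<close>
    have "qpoch q (\<alpha> * x r) (Suc (M r + msize n k)) = (1 - \<alpha> * x r) * qpoch q (\<alpha> * q * x r) (M r) *
        qpoch q (\<alpha> * x r * q ^ Suc (M r)) (msize n k)"
    proof -
      have "qpoch q (\<alpha> * x r) (1 + M r) = (1 - \<alpha> * x r) * qpoch q (\<alpha> * q * x r) (M r)"
        unfolding qpoch_add by (simp add: qpoch_def mult_ac)
      then show ?thesis
        using qpoch_add[of q "\<alpha> * x r" "Suc (M r)" "msize n k"] by simp
    qed
    with qpoch_generic[OF gen r, of "Suc (M r + msize n k)"] show ?thesis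
      by (simp add: divide_simps)
  qed
  then have "(\<Prod>r=1..n. (1 - \<alpha> * x r * q ^ (k r + msize n k)) / (1 - \<alpha> * x r) *
      (qpoch q (\<alpha> * x r) (msize n k) / qpoch q (\<alpha> * x r * q ^ Suc (M r)) (msize n k))) =
    (\<Prod>r=1..n. qpoch q (\<alpha> * q * x r) (M r) * ((1 - \<alpha> * x r * q ^ (k r + msize n k)) * qpoch q (\<alpha> * x r) (msize n k) /
        qpoch q (\<alpha> * x r) (Suc (M r + msize n k))))"
    by (intro prod.cong refl)
  then show ?thesis
    unfolding Arow_def Amat_def prod.distrib by (simp add: mult.assoc mult.left_commute)
qed

lemma sum_Arow_Bmat:
  assumes \<alpha>: "\<And>r. r \<in> {1..n} \<Longrightarrow> \<alpha> * x r \<noteq> 1"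
      "\<And>r j. r \<in> {1..n} \<Longrightarrow> qpoch q (\<alpha> * x r * q ^ Suc (M r)) j \<noteq> 0"
    and q1: "norm q < 1" 
    and S: "S = (\<Pi>\<^sub>E r\<in>{1..n}. {..N r})" and M: "M \<in> S" and m: "m \<in> S"
  shows "(\<Sum>k\<in>S. Arow \<alpha> M k * Bmat \<alpha> k m) = (\<Prod>r=1..n. qpoch q (\<alpha> * q * x r) (M r)) * of_bool (M = m)"
proof -
  let ?L = "\<lambda>\<alpha>. \<Sum>k\<in>S. Arow \<alpha> M k * Bmat \<alpha> k m"
  let ?R = "\<lambda>\<alpha>. (\<Prod>r=1..n. qpoch q (\<alpha> * q * x r) (M r)) * of_bool (M = m)"
  have L: "isCont ?L \<alpha>"
    unfolding Arow_def Bmat_def qpoch_def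
    by (intro continuous_intros) (use \<alpha> den_nonzero vdm_nonzero q0 in \<open>auto simp: qpoch_def\<close>)
  have R: "isCont ?R \<alpha>"
    unfolding qpoch_def by (intro continuous_intros)
  have "\<forall>\<^sub>F \<beta> in at \<alpha>. ?L \<beta> = ?R \<beta>"
  proof -
    have "\<forall>\<^sub>F \<beta> in at \<alpha>. \<beta> * x r * q ^ i \<noteq> 1" for r i
    proof (cases "x r = 0")
      case False
      have "\<forall>\<^sub>F \<beta> in at \<alpha>. \<beta> \<noteq> 1 / (x r * q ^ i)"
        by (metis eventually_neq_at_within)
      then show ?thesis
        by eventually_elim (use False q0 in \<open>auto simp: field_simps\<close>)
    qed simp
    then have fin: "\<forall>\<^sub>F \<beta> in at \<alpha>. \<forall>r\<in>{1..n}. \<forall>i\<in>{..<K}. \<beta> * x r * q ^ i \<noteq> 1" for K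
      by (simp add: eventually_ball_finite_distrib)
    \<comment> \<open>A strict bound for all |\<beta> x_r| with \<beta> near \<alpha>. With |q|^K <
      1/B the conditions for i \<ge> K hold automatically, so only finitely many values of \<beta>
      have to be avoided.\<close>
    define B where "B = (norm \<alpha> + 1) * (\<Sum>r=1..n. norm (x r)) + 1"
    have B: "B > 0" by (simp add: B_def add_nonneg_pos sum_nonneg)
    obtain K where K: "norm q ^ K < 1 / B"
      using real_arch_pow_inv[of "1 / B" "norm q"] B q1 by auto
    have "\<forall>\<^sub>F \<beta> in at \<alpha>. norm \<beta> < norm \<alpha> + 1"
    proof -
      have "((\<lambda>\<beta>. norm \<beta>) \<longlongrightarrow> norm \<alpha>) (at \<alpha>)" by (intro tendsto_intros)
      then show ?thesis by (rule order_tendstoD) simp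
    qed
    with fin[of K] show ?thesis
    proof eventually_elim
      case (elim \<beta>)
      have "\<beta> * x r * q ^ i \<noteq> 1" if r: "r \<in> {1..n}" for r i
      proof (cases "i < K")
        case False
        have "norm (\<beta> * x r) \<le> (norm \<alpha> + 1) * (\<Sum>r=1..n. norm (x r))"
          unfolding norm_mult using elim(2) r by (intro mult_mono member_le_sum) auto
        then have "norm (\<beta> * x r) < B" by (simp add: B_def)
        moreover have "norm q ^ i \<le> norm q ^ K" using False q1 by (intro power_decreasing) auto
        then have "norm q ^ i < 1 / B" using K by linarith
        ultimately have "norm (\<beta> * x r) * norm q ^ i < B * (1 / B)"
          using B by (intro mult_strict_mono') auto
        then have "norm (\<beta> * x r * q ^ i) < 1" using B by (simp add: norm_mult norm_power)
        then show ?thesis by auto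
      qed (use elim(1) r in auto)
      then have "generic \<beta>" by (simp add: generic_def)
      then show ?case
        using sum_Amat_Bmat[OF _ S M m, of \<beta>]
        by (simp add: Arow_generic mult.assoc sum_distrib_left[symmetric])
    qed
  qed
  then have "(?L \<longlongrightarrow> ?R \<alpha>) (at \<alpha>)"
    using R by (simp only: isCont_def tendsto_cong)
  with L show ?thesis
    unfolding isCont_def by (rule tendsto_unique[OF at_neq_bot])
qed

end

subsection \<open>The terminating case\<close>

lemma convergent_prod_qpoch:
  fixes q z :: complex
  assumes "norm q < 1"
  shows "convergent_prod (\<lambda>i. 1 - z * q ^ i)"
proof (rule abs_convergent_prod_imp_convergent_prod, rule summable_imp_abs_convergent_prod)
  have "summable (\<lambda>i. norm z * norm q ^ i)"
    using assms by (intro summable_mult summable_geometric) simp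
  then show "summable (\<lambda>i. norm (1 - z * q ^ i - 1))" by (simp add: norm_mult norm_power)
qed

lemma qpoch_inf_split:
  assumes "norm q < 1"
  shows "qpoch_inf q z = qpoch q z k * qpoch_inf q (z * q ^ k)"
  using has_prod_unique[OF has_prod_ignore_initial_segment'[OF convergent_prod_qpoch[OF assms], of z k]]
  by (simp add: qpoch_inf_def qpoch_def power_add mult_ac)

text \<open>A coincidence x_r q^d = x_s is a zero of (q x_r / x_s)_d if d > 0, and of a Vandermonde
  denominator if d = 0 and r \<noteq> s.\<close>

lemma denominators_nonzero_imp_q_nodes:
  assumes "0 < norm q" "n \<ge> 1" and den: "denominators_nonzero n q \<alpha> b x a"
  shows "q_nodes n q x"
proof
  have x0: "x r \<noteq> 0" if "r \<in> {1..n}" for r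
    using den that by (auto simp: denominators_nonzero_def)
  have neq: "x r * q ^ Suc i \<noteq> x s" if r: "r \<in> {1..n}" and s: "s \<in> {1..n}" for r s i
  proof
    assume "x r * q ^ Suc i = x s"
    then have "1 - q * x r / x s * q ^ i = 0" using x0[OF s] by (simp add: field_simps)
    then have "qpoch q (q * x r / x s) (Suc i) = 0" by (simp add: qpoch_Suc)
    then show False using den r s by (auto simp: denominators_nonzero_def)
  qed
  show q0: "q \<noteq> 0" using assms by auto
  fix r s i j assume r: "r \<in> {1..n}" and s: "s \<in> {1..n}" and eq: "x r * q ^ i = x s * q ^ j"
  have "i = j"
  proof (rule linorder_cases[of i j])
    assume "i < j"
    then obtain d where "j = i + Suc d" using less_iff_Suc_add by auto
    then have "x s * q ^ Suc d = x r" using eq q0 by (simp add: power_add)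
    then show ?thesis using neq[OF s r] by blast
  next
    assume "j < i"
    then obtain d where "i = j + Suc d" using less_iff_Suc_add by auto
    then have "x r * q ^ Suc d = x s" using eq q0 by (simp add: power_add)
    then show ?thesis using neq[OF r s] by blast
  qed
  then have "x r = x s" using eq q0 by simp
  moreover have "x r \<noteq> x s" if "r < s" "r \<in> {1..n}" "s \<in> {1..n}" for r s
    using den that x0 by (fastforce simp: denominators_nonzero_def)
  ultimately have "r = s" using r s by (metis linorder_neqE_nat)
  with \<open>i = j\<close> show "r = s \<and> i = j" by simp
qed (use assms in auto)

section \<open>The series written in terms of the two matrices\<close>

context q_nodes begin

definition x_prod :: complex where "x_prod = (\<Prod>s=1..n. x s)"

lemma x_prod_nonzero: "x_prod \<noteq> 0"
  using x_nonzero by (simp add: x_prod_def)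

text \<open>A factor depending on s alone is collected once for every pair (r, i) with i < k_r, that
  is, |k| times.\<close>

lemma prod_scaled:
  fixes f g :: "nat \<Rightarrow> nat \<Rightarrow> nat \<Rightarrow> complex"
  assumes "\<And>r s i. r \<in> {1..n} \<Longrightarrow> s \<in> {1..n} \<Longrightarrow> f r s i = c s * g r s i"
  shows "(\<Prod>r=1..n. \<Prod>s=1..n. \<Prod>i<k r. f r s i) =
    (\<Prod>s=1..n. c s) ^ msize n k * (\<Prod>r=1..n. \<Prod>i<k r. \<Prod>s=1..n. g r s i)"
proof -
  have "(\<Prod>r=1..n. \<Prod>s=1..n. \<Prod>i<k r. f r s i) = (\<Prod>r=1..n. \<Prod>i<k r. \<Prod>s=1..n. f r s i)"
    by (intro prod.cong refl prod.swap)
  also have "\<dots> = (\<Prod>r=1..n. \<Prod>i<k r. \<Prod>s=1..n. c s * g r s i)"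
    using assms by (intro prod.cong refl)
  also have "\<dots> = (\<Prod>s=1..n. c s) ^ msize n k * (\<Prod>r=1..n. \<Prod>i<k r. \<Prod>s=1..n. g r s i)"
    by (simp add: prod.distrib msize_def power_sum)
  finally show ?thesis .
qed

text \<open>Here q x_r / (x_s a_s) = q^(-M_s) x_r / x_s, so M takes the place that k has in the
  inner sum and the same \<open>num\<close> appears.\<close>

lemma a_factor_terminating:
  assumes a: "\<And>s. s \<in> {1..n} \<Longrightarrow> a s = q ^ Suc (M s)"
  shows "a_factor n q x a k = (q ^ n / x_prod) ^ msize n k * num M k"
proof -
  have "a s - q * x r / x s * q ^ i = q / x s * (x s * q ^ M s - x r * q ^ i)" if "s \<in> {1..n}" for r s i
    using a[OF that] x_nonzero[OF that] by (simp add: field_simps)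
  then have "a_factor n q x a k = (\<Prod>s=1..n. q / x s) ^ msize n k * num M k"
    unfolding a_factor_def num_def by (intro prod_scaled) simp
  then show ?thesis by (simp add: prod_dividef x_prod_def)
qed

lemma prod_qpoch_eq_den:
  "(\<Prod>r=1..n. \<Prod>s=1..n. qpoch q (q * x r / x s) (k r)) = den k / x_prod ^ msize n k"
proof -
  have "1 - q * x r / x s * q ^ i = 1 / x s * (x s - x r * q ^ Suc i)" if "s \<in> {1..n}" for r s i
    using x_nonzero[OF that] by (simp add: field_simps)
  then have "(\<Prod>r=1..n. \<Prod>s=1..n. qpoch q (q * x r / x s) (k r)) =
      (\<Prod>s=1..n. 1 / x s) ^ msize n k * den k"
    unfolding qpoch_def den_def by (intro prod_scaled) simp
  then show ?thesis by (simp add: prod_dividef x_prod_def power_divide)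
qed

lemma prod_qpoch_eq_num:
  "(\<Prod>r=1..n. \<Prod>s=1..n. qpoch q (q powi (- int (k s)) * x r / x s) (m r)) =
    num k m / (x_prod ^ msize n m * q ^ (msize n k * msize n m))"
proof -
  have "1 - q powi (- int (k s)) * x r / x s * q ^ i = 1 / (x s * q ^ k s) * (x s * q ^ k s - x r * q ^ i)"
    if "s \<in> {1..n}" for r s i
    using x_nonzero[OF that] q0 by (simp add: field_simps power_int_minus)
  then have "(\<Prod>r=1..n. \<Prod>s=1..n. qpoch q (q powi (- int (k s)) * x r / x s) (m r)) =
      (\<Prod>s=1..n. 1 / (x s * q ^ k s)) ^ msize n m * num k m"
    unfolding qpoch_def num_def by (intro prod_scaled) simp
  also have "(\<Prod>s=1..n. 1 / (x s * q ^ k s)) = 1 / (x_prod * q ^ msize n k)"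
    by (simp add: prod_dividef prod.distrib x_prod_def power_sum msize_def)
  finally show ?thesis by (simp add: power_divide power_mult_distrib power_mult)
qed

text \<open>Each s is the larger index of s - 1 pairs, so the power of q is the product of q^(k_s)
  over the pairs r < s; it clears the negative powers in the ratio.\<close>

lemma vandermonde_ratio_eq_vdm:
  "vandermonde_ratio n q x k * q ^ (\<Sum>r=1..n. (r - 1) * k r) = vdm k / vdm (\<lambda>_. 0)"
proof -
  let ?E = "\<lambda>r. {s\<in>{1..n}. r < s}"
  have E: "{r+1..n} = ?E r" if "r \<in> {1..n}" for r using that by auto
  have "(\<Sum>r=1..n. (r - 1) * k r) = (\<Sum>s=1..n. \<Sum>r\<in>{r\<in>{1..n}. r < s}. k s)"
  proof (intro sum.cong refl)
    fix s assume "s \<in> {1..n}"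
    then have "{r\<in>{1..n}. r < s} = {1..<s}" by auto
    then show "(s - 1) * k s = (\<Sum>r\<in>{r\<in>{1..n}. r < s}. k s)" by simp
  qed
  also have "\<dots> = (\<Sum>r=1..n. \<Sum>s\<in>?E r. k s)" by (rule sum.swap_restrict) auto
  finally have "q ^ (\<Sum>r=1..n. (r - 1) * k r) = (\<Prod>r=1..n. \<Prod>s\<in>?E r. q ^ k s)"
    by (simp add: power_sum)
  moreover have "vandermonde_ratio n q x k =
     (\<Prod>r=1..n. \<Prod>s\<in>?E r. (1 - q powi (int (k r) - int (k s)) * x r / x s) / (1 - x r / x s))"
    unfolding vandermonde_ratio_def using E by (intro prod.cong) auto
  ultimately have "vandermonde_ratio n q x k * q ^ (\<Sum>r=1..n. (r - 1) * k r) =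
     (\<Prod>r=1..n. \<Prod>s\<in>?E r. (1 - q powi (int (k r) - int (k s)) * x r / x s) / (1 - x r / x s) * q ^ k s)"
    by (simp only: prod.distrib)
  also have "\<dots> = (\<Prod>r=1..n. \<Prod>s\<in>?E r. (x s * q ^ k s - x r * q ^ k r) / (x s - x r))"
  proof (intro prod.cong refl)
    fix r s assume r: "r \<in> {1..n}" and "s \<in> ?E r"
    then have s: "s \<in> {1..n}" "r < s" by auto
    then have ne: "x r \<noteq> x s" using nodes_inj[OF r s(1), of 0 0] by auto
    then show "(1 - q powi (int (k r) - int (k s)) * x r / x s) / (1 - x r / x s) * q ^ k s =
        (x s * q ^ k s - x r * q ^ k r) / (x s - x r)"
      using x_nonzero[OF s(1)] q0 by (simp add: power_int_diff field_simps)
  qed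
  finally show ?thesis by (simp add: vdm_def vandermonde_def prod_dividef)
qed

lemma expansion_term_terminating:
  assumes a: "\<And>s. s \<in> {1..n} \<Longrightarrow> a s = q ^ Suc (M s)"
  shows "expansion_term n q \<alpha> b x f a k = Arow \<alpha> M k * inner_sum n q \<alpha> b x f k"
proof -
  have K: "(\<Sum>r=1..n. (int r - 1) * int (k r)) = int (\<Sum>r=1..n. (r - 1) * k r)"
    unfolding of_nat_sum by (intro sum.cong) (auto simp: of_nat_diff)
  have pw: "q powi ((\<Sum>r=1..n. (int r - 1) * int (k r)) - int n * int (msize n k)) =
      q ^ (\<Sum>r=1..n. (r - 1) * k r) / (q ^ n) ^ msize n k"
  proof -
    have "q powi (int i - int j) = q ^ i / q ^ j" for i j
      using q0 by (simp add: power_int_diff)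
    then show ?thesis
      unfolding K of_nat_mult[symmetric] power_mult[symmetric] .
  qed
  have af: "a_factor n q x a k = (q ^ n / x_prod) ^ msize n k * num M k"
    by (rule a_factor_terminating) (rule a)
  \<comment> \<open>The power (q^n)^|k| arising here cancels the q^(-n|k|) of the series.\<close>
  have "a_factor n q x a k / (\<Prod>r=1..n. \<Prod>s=1..n. qpoch q (q * x r / x s) (k r)) =
      (q ^ n) ^ msize n k * (num M k / den k)"
    unfolding af prod_qpoch_eq_den
    using x_prod_nonzero by (simp add: power_divide)
  moreover have "(\<Prod>r=1..n. qpoch q (\<alpha> * x r) (msize n k) / qpoch q (\<alpha> * x r * a r) (msize n k)) =
     (\<Prod>r=1..n. qpoch q (\<alpha> * x r) (msize n k) / qpoch q (\<alpha> * x r * q ^ Suc (M r)) (msize n k))"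
    using a by (intro prod.cong) auto
  ultimately show ?thesis
    unfolding expansion_term_def Arow_def pw vandermonde_ratio_eq_vdm[symmetric]
    using q0 by (simp add: mult_ac)
qed

lemma inner_sum_eq_Bmat:
  "inner_sum n q \<alpha> b x f k =
    (\<Sum>m\<in>(\<Pi>\<^sub>E r\<in>{1..n}. {..k r}).
       Bmat \<alpha> k m * (f (\<alpha> * q ^ Suc (msize n m)) / (\<Prod>r=1..n. qpoch q (\<alpha> * b * x r) (m r))))"
  unfolding inner_sum_def atLeast0AtMost
proof (intro sum.cong refl)
  fix m
  have "r * m r = m r + (r - 1) * m r" if "r \<in> {1..n}" for r
    using that by (cases r) auto
  then have "(\<Sum>r=1..n. r * m r) = msize n m + (\<Sum>r=1..n. (r - 1) * m r)"
    by (simp add: msize_def flip: sum.distrib)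
  then have pw: "q ^ (\<Sum>r=1..n. r * m r) = q ^ msize n m * q ^ (\<Sum>r=1..n. (r - 1) * m r)"
    by (simp add: power_add)
  show "vandermonde_ratio n q x m *
        (\<Prod>r=1..n. \<Prod>s=1..n.
           qpoch q (q powi (- int (k s)) * x r / x s) (m r) / qpoch q (q * x r / x s) (m r)) *
        (\<Prod>r=1..n. qpoch q (\<alpha> * x r * q ^ msize n k) (m r) / qpoch q (\<alpha> * b * x r) (m r)) *
        q ^ (\<Sum>r=1..n. r * m r) *
        f (\<alpha> * q ^ (1 + msize n m)) =
     Bmat \<alpha> k m * (f (\<alpha> * q ^ Suc (msize n m)) / (\<Prod>r=1..n. qpoch q (\<alpha> * b * x r) (m r)))"
    unfolding prod_dividef prod_qpoch_eq_num prod_qpoch_eq_den Bmat_def pw vandermonde_ratio_eq_vdm[symmetric]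
    using x_prod_nonzero by (simp add: mult_ac)
qed

end

lemma expansion_terminating:
  assumes q: "0 < norm q" "norm q < 1" and n: "n \<ge> 1"
    and den: "denominators_nonzero n q \<alpha> b x a"
    and a: "\<And>r. r \<in> {1..n} \<Longrightarrow> N r > 0 \<and> a r = q ^ N r"
  shows "(expansion_term n q \<alpha> b x f a has_sum expansion_lhs n q \<alpha> b x f a) (multi_indices n)"
proof -
  interpret q_nodes n q x
    by (rule denominators_nonzero_imp_q_nodes[OF q(1) n den])
  \<comment> \<open>Since q / a_r = q^(-M_r), the series stops at k \<le> M; restricting the
    function makes M itself an element of the box \<open>S\<close>.\<close>
  define M where "M = (\<lambda>r\<in>{1..n}. N r - 1)"
  define S where "S = (\<Pi>\<^sub>E r\<in>{1..n}. {..M r})"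
  have aM: "a r = q ^ Suc (M r)" if "r \<in> {1..n}" for r
    using a[OF that] that by (simp add: M_def flip: power_Suc)
  have MS: "M \<in> S" by (auto simp: S_def M_def)
  have finS: "finite S" by (auto simp: S_def intro!: finite_PiE)
  define g where "g m = f (\<alpha> * q ^ Suc (msize n m)) / (\<Prod>r=1..n. qpoch q (\<alpha> * b * x r) (m r))" for m
  have "(\<Sum>k\<in>S. expansion_term n q \<alpha> b x f a k) = (\<Sum>k\<in>S. \<Sum>m\<in>S. Arow \<alpha> M k * Bmat \<alpha> k m * g m)"
  proof (intro sum.cong refl)
    fix k assume k: "k \<in> S"
    have "inner_sum n q \<alpha> b x f k = (\<Sum>m\<in>S. Bmat \<alpha> k m * g m)"
      unfolding inner_sum_eq_Bmat g_def
    proof (rule sum.mono_neutral_left[OF finS])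
      show "(\<Pi>\<^sub>E r\<in>{1..n}. {..k r}) \<subseteq> S"
        using k unfolding S_def by (intro PiE_mono) (auto simp: PiE_iff)
      show "\<forall>m\<in>S - (\<Pi>\<^sub>E r\<in>{1..n}. {..k r}).
          Bmat \<alpha> k m * (f (\<alpha> * q ^ Suc (msize n m)) / (\<Prod>r=1..n. qpoch q (\<alpha> * b * x r) (m r))) = 0"
      proof
        fix m assume m: "m \<in> S - (\<Pi>\<^sub>E r\<in>{1..n}. {..k r})"
        then have "\<not> m \<le> k" by (auto simp: S_def PiE_iff le_fun_def)
        then have "num k m = 0" using k m unfolding S_def by (intro not_le_imp_num_eq_0) auto
        then show "Bmat \<alpha> k m * (f (\<alpha> * q ^ Suc (msize n m)) / (\<Prod>r=1..n. qpoch q (\<alpha> * b * x r) (m r))) = 0"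
          by (simp add: Bmat_def)
      qed
    qed
    then show "expansion_term n q \<alpha> b x f a k = (\<Sum>m\<in>S. Arow \<alpha> M k * Bmat \<alpha> k m * g m)"
      using expansion_term_terminating[where a = a and M = M, OF aM, where k = k] by (simp add: sum_distrib_left mult.assoc)
  qed
  \<comment> \<open>Exchanging the sums isolates row M of the matrix product, which selects m =
    M.\<close>
  also have "\<dots> = (\<Sum>m\<in>S. (\<Sum>k\<in>S. Arow \<alpha> M k * Bmat \<alpha> k m) * g m)"
    by (subst sum.swap) (simp add: sum_distrib_right)
  also have "\<dots> = (\<Sum>m\<in>S. (\<Prod>r=1..n. qpoch q (\<alpha> * q * x r) (M r)) * of_bool (M = m) * g m)"
  proof (intro sum.cong refl)
    fix m assume m: "m \<in> S"
    have "(\<Sum>k\<in>S. Arow \<alpha> M k * Bmat \<alpha> k m) = (\<Prod>r=1..n. qpoch q (\<alpha> * q * x r) (M r)) * of_bool (M = m)"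
    proof (rule sum_Arow_Bmat[OF _ _ q(2) S_def MS m])
      show "\<alpha> * x r \<noteq> 1" "qpoch q (\<alpha> * x r * q ^ Suc (M r)) j \<noteq> 0" if "r \<in> {1..n}" for r j
        using den that unfolding denominators_nonzero_def aM[OF that, symmetric] by auto
    qed
    then show "(\<Sum>k\<in>S. Arow \<alpha> M k * Bmat \<alpha> k m) * g m =
        (\<Prod>r=1..n. qpoch q (\<alpha> * q * x r) (M r)) * of_bool (M = m) * g m" by simp
  qed
  also have "\<dots> = (\<Sum>m\<in>{M}. (\<Prod>r=1..n. qpoch q (\<alpha> * q * x r) (M r)) * of_bool (M = m) * g m)"
    using MS finS by (intro sum.mono_neutral_right) auto
  also have "\<dots> = f (\<alpha> * q ^ Suc (msize n M)) *
      (\<Prod>r=1..n. qpoch q (\<alpha> * q * x r) (M r) / qpoch q (\<alpha> * b * x r) (M r))"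
    by (simp add: g_def prod_dividef)
  also have "\<dots> = expansion_lhs n q \<alpha> b x f a"
  proof -
    \<comment> \<open>The product of the a_r is q^(|M| + n); the factor q^(1-n) brings the argument
      of f to \<alpha> q^(1+|M|).\<close>
    have "int (\<Sum>r=1..n. Suc (M r)) + (1 - int n) = int (Suc (msize n M))"
      using n by (simp add: msize_def sum_Suc)
    then have "(\<Prod>r=1..n. q ^ Suc (M r)) * q powi (1 - int n) = q ^ Suc (msize n M)"
      using q0 by (metis power_sum power_int_add power_int_of_nat)
    moreover have "(\<Prod>r=1..n. a r) = (\<Prod>r=1..n. q ^ Suc (M r))"
      using aM by (intro prod.cong) auto
    ultimately have y: "\<alpha> * (\<Prod>r=1..n. a r) * q powi (1 - int n) = \<alpha> * q ^ Suc (msize n M)"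
      by (simp add: mult.assoc)
    have "qpoch q (\<alpha> * q * x r) (M r) / qpoch q (\<alpha> * b * x r) (M r) =
       (qpoch_inf q (\<alpha> * q * x r) * qpoch_inf q (\<alpha> * a r * b * x r / q)) /
                 (qpoch_inf q (\<alpha> * b * x r) * qpoch_inf q (\<alpha> * a r * x r))" if r: "r \<in> {1..n}" for r
    proof -
      have e: "\<alpha> * q * x r * q ^ M r = \<alpha> * a r * x r" "\<alpha> * b * x r * q ^ M r = \<alpha> * a r * b * x r / q"
        using aM[OF r] q0 by simp_all
      have "qpoch_inf q (\<alpha> * q * x r) = qpoch q (\<alpha> * q * x r) (M r) * qpoch_inf q (\<alpha> * a r * x r)"
        "qpoch_inf q (\<alpha> * b * x r) = qpoch q (\<alpha> * b * x r) (M r) * qpoch_inf q (\<alpha> * a r * b * x r / q)"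
        using qpoch_inf_split[OF q(2), of "\<alpha> * q * x r" "M r"] qpoch_inf_split[OF q(2), of "\<alpha> * b * x r" "M r"]
        by (simp_all only: e)
      \<comment> \<open>The first condition also makes the tail (\<alpha> a_r b x_r / q)_\<infinity>
        nonzero, so that it can be cancelled.\<close>
      moreover have "qpoch_inf q (\<alpha> * b * x r) \<noteq> 0" "qpoch_inf q (\<alpha> * a r * x r) \<noteq> 0"
        using den r by (auto simp: denominators_nonzero_def)
      ultimately show ?thesis by simp
    qed
    then show ?thesis
      unfolding expansion_lhs_def y by (intro arg_cong2[of _ _ _ _ "(*)"] refl prod.cong)
  qed
  finally have "(expansion_term n q \<alpha> b x f a has_sum expansion_lhs n q \<alpha> b x f a) S"
    using has_sum_finite[OF finS, of "expansion_term n q \<alpha> b x f a"] by simp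
  moreover have zero: "expansion_term n q \<alpha> b x f a k = 0" if "k \<in> multi_indices n - S" for k
  proof -
    have k: "k \<in> (\<Pi>\<^sub>E r\<in>{1..n}. UNIV)" using that by (simp add: multi_indices_def)
    then have "\<not> k \<le> M" using that by (auto simp: S_def PiE_iff le_fun_def)
    then have "num M k = 0" using MS k unfolding S_def by (intro not_le_imp_num_eq_0) auto
    then show ?thesis using expansion_term_terminating[where a = a and M = M, OF aM, where k = k] by (simp add: Arow_def)
  qed
  moreover have "S \<subseteq> multi_indices n"
    unfolding S_def multi_indices_def by (intro PiE_mono) auto
  then have "(expansion_term n q \<alpha> b x f a has_sum l) S \<longleftrightarrow>
      (expansion_term n q \<alpha> b x f a has_sum l) (multi_indices n)" for l
    by (intro has_sum_cong_neutral zero) auto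
  ultimately show ?thesis by simp
qed

subsection \<open>Analytic continuation\<close>

lemma multi_analytic_on_imp_holomorphic:
  assumes F: "multi_analytic_on n F (polydisc n (\<lambda>_. 0) R)"
    and c: "c \<in> polydisc n (\<lambda>_. 0) R" and r: "r \<in> {1..n}"
  shows "(\<lambda>w. F (c(r := w))) holomorphic_on ball 0 R"
  unfolding holomorphic_on_def
proof
  fix w0 :: complex assume w0: "w0 \<in> ball 0 R"
  \<comment> \<open>Centring at c with its r-th coordinate moved to w0 makes all other differences
    vanish, so only the monomials in the r-th variable, indexed by \<open>e\<close>,
    survive.\<close>
  define c' where "c' = c(r := w0)"
  have "c' \<in> polydisc n (\<lambda>_. 0) R" using c w0 by (auto simp: polydisc_def c'_def)
  then obtain \<rho> C where \<rho>: "\<rho> > 0" and C: "\<And>z. z \<in> polydisc n c' \<rho> \<Longrightarrow>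
      ((\<lambda>\<nu>. C \<nu> * (\<Prod>s=1..n. (z s - c' s) ^ \<nu> s)) has_sum F z) (multi_indices n)"
    using F unfolding multi_analytic_on_def by blast
  define e :: "nat \<Rightarrow> nat \<Rightarrow> nat" where "e j = (\<lambda>s\<in>{1..n}. if s = r then j else 0)" for j
  have inj: "inj e"
  proof (rule injI)
    fix i j assume "e i = e j"
    then have "e i r = e j r" by simp
    then show "i = j" using r by (simp add: e_def)
  qed
  have "(\<lambda>j. C (e j) * (w - w0) ^ j) sums F (c(r := w))" if w: "w \<in> ball w0 \<rho>" for w
  proof -
    define z where "z = c(r := w)"
    define t where "t \<nu> = C \<nu> * (\<Prod>s=1..n. (z s - c' s) ^ \<nu> s)" for \<nu>
    have "z \<in> polydisc n c' \<rho>" using w \<rho> by (auto simp: polydisc_def z_def c'_def)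
    then have "(t has_sum F z) (multi_indices n)" unfolding t_def by (rule C)
    moreover have "t \<nu> = 0" if \<nu>: "\<nu> \<in> multi_indices n - range e" for \<nu>
    proof -
      have "\<exists>s\<in>{1..n}. s \<noteq> r \<and> \<nu> s \<noteq> 0"
      proof (rule ccontr)
        assume "\<not> ?thesis"
        then have "\<nu> = e (\<nu> r)"
          using \<nu> by (auto simp: e_def multi_indices_def PiE_iff extensional_def fun_eq_iff)
        then show False using \<nu> by blast
      qed
      then obtain s where "s \<in> {1..n}" "s \<noteq> r" "\<nu> s \<noteq> 0" by blast
      then have "(\<Prod>s=1..n. (z s - c' s) ^ \<nu> s) = 0"
        by (intro prod_zero bexI[of _ s]) (auto simp: z_def c'_def)
      then show ?thesis by (simp add: t_def)
    qed
    moreover have "range e \<subseteq> multi_indices n" by (auto simp: e_def multi_indices_def)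
    then have "(t has_sum l) (multi_indices n) \<longleftrightarrow> (t has_sum l) (range e)" for l
      by (intro has_sum_cong_neutral) (use calculation in auto)
    ultimately have "(t has_sum F z) (range e)" by simp
    then have "((t \<circ> e) has_sum F z) UNIV" using has_sum_reindex[OF inj] by blast
    moreover have "(t \<circ> e) j = C (e j) * (w - w0) ^ j" for j
    proof -
      have "(\<Prod>s=1..n. (z s - c' s) ^ e j s) = (\<Prod>s=1..n. if s = r then (w - w0) ^ j else 1)"
        by (intro prod.cong) (auto simp: e_def z_def c'_def)
      then show ?thesis using r by (simp add: t_def)
    qed
    then have "t \<circ> e = (\<lambda>j. C (e j) * (w - w0) ^ j)" by auto
    ultimately show ?thesis by (simp only: z_def has_sum_imp_sums)
  qed
  then have "(\<lambda>w. F (c(r := w))) holomorphic_on ball w0 \<rho>"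
    by (rule power_series_holomorphic)
  then have "(\<lambda>w. F (c(r := w))) field_differentiable (at w0)"
    using \<rho> by (intro holomorphic_on_imp_differentiable_at[of _ "ball w0 \<rho>"]) auto
  then show "(\<lambda>w. F (c(r := w))) field_differentiable (at w0 within ball 0 R)"
    by (rule field_differentiable_at_within)
qed

lemma multi_analytic_identity:
  assumes F: "multi_analytic_on n F (polydisc n (\<lambda>_. 0) R)"
    and G: "multi_analytic_on n G (polydisc n (\<lambda>_. 0) R)"
    and R: "R > 0" and U: "U \<subseteq> ball 0 R" "0 islimpt U"
    and eq: "\<And>z. (\<And>r. r \<in> {1..n} \<Longrightarrow> z r \<in> U) \<Longrightarrow> F z = G z"
    and z: "z \<in> polydisc n (\<lambda>_. 0) R"
  shows "F z = G z"
proof -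
  \<comment> \<open>The first j coordinates are free in the disc and the others confined to U; each
    induction step frees one more.\<close>
  have "F z = G z" if "j \<le> n" "z \<in> polydisc n (\<lambda>_. 0) R" "\<And>r. r \<in> {1..n} \<Longrightarrow> j < r \<Longrightarrow> z r \<in> U" for j z
    using that
  proof (induction j arbitrary: z)
    case 0
    then show ?case by (intro eq) auto
  next
    case (Suc j)
    have r: "Suc j \<in> {1..n}" using Suc.prems by auto
    have "F (z(Suc j := z (Suc j))) - G (z(Suc j := z (Suc j))) = 0"
    proof (rule analytic_continuation[where f = "\<lambda>w. F (z(Suc j := w)) - G (z(Suc j := w))" and \<xi> = 0])
      show "(\<lambda>w. F (z(Suc j := w)) - G (z(Suc j := w))) holomorphic_on ball 0 R"
        using multi_analytic_on_imp_holomorphic[OF F Suc.prems(2) r]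
          multi_analytic_on_imp_holomorphic[OF G Suc.prems(2) r] by (intro holomorphic_intros)
      show "F (z(Suc j := w)) - G (z(Suc j := w)) = 0" if w: "w \<in> U" for w
      proof -
        have "F (z(Suc j := w)) = G (z(Suc j := w))"
          using Suc.prems w U(1) by (intro Suc.IH) (auto simp: polydisc_def)
        then show ?thesis by simp
      qed
      show "z (Suc j) \<in> ball 0 R" using Suc.prems(2) r by (auto simp: polydisc_def)
    qed (use R U in auto)
    then show ?case by simp
  qed
  from this[of n z] z show ?thesis by auto
qed

lemma qpoch_nonzero:
  assumes q: "norm q < 1" and z: "norm z < 1"
  shows "qpoch q z j \<noteq> 0" "qpoch_inf q z \<noteq> 0"
proof -
  have "z * q ^ i \<noteq> 1" for i
  proof -
    have "norm z * norm q ^ i \<le> norm z * 1"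
      using q by (intro mult_left_mono power_le_one) auto
    then have "norm (z * q ^ i) < 1" using z by (simp add: norm_mult norm_power)
    then show ?thesis by auto
  qed
  then have ne: "1 - z * q ^ i \<noteq> 0" for i by (metis right_minus_eq)
  show "qpoch q z j \<noteq> 0" using ne by (simp add: qpoch_def)
  show "qpoch_inf q z \<noteq> 0"
    unfolding qpoch_inf_def by (rule prodinf_nonzero[OF convergent_prod_qpoch[OF q] ne])
qed

theorem theorem1p7:
  fixes n :: nat and q \<alpha> b :: complex and x a :: "nat \<Rightarrow> complex"
    and f :: "complex \<Rightarrow> complex"
  assumes "0 < norm q" and "norm q < 1" and "n \<ge> 1"
    and "denominators_nonzero n q \<alpha> b x a"
    and "(\<exists>R>0. a \<in> polydisc n (\<lambda>_. 0) R \<and>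
            multi_analytic_on n (expansion_lhs n q \<alpha> b x f) (polydisc n (\<lambda>_. 0) R) \<and>
            multi_analytic_on n (expansion_rhs n q \<alpha> b x f) (polydisc n (\<lambda>_. 0) R) \<and>
            (\<forall>a'\<in>polydisc n (\<lambda>_. 0) R.
               (\<lambda>k. norm (expansion_term n q \<alpha> b x f a' k)) summable_on multi_indices n))
         \<or> (\<exists>N :: nat \<Rightarrow> nat. \<forall>r\<in>{1..n}. N r > 0 \<and> a r = q ^ N r)"
  shows "(expansion_term n q \<alpha> b x f a has_sum expansion_lhs n q \<alpha> b x f a) (multi_indices n)"
  using assms(5)
proof
  assume "\<exists>N :: nat \<Rightarrow> nat. \<forall>r\<in>{1..n}. N r > 0 \<and> a r = q ^ N r"
  then show ?thesis
    using expansion_terminating[OF assms(1-4)] by blast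
next
  let ?D = "polydisc n (\<lambda>_. 0)"
  assume "\<exists>R>0. a \<in> ?D R \<and>
      multi_analytic_on n (expansion_lhs n q \<alpha> b x f) (?D R) \<and>
      multi_analytic_on n (expansion_rhs n q \<alpha> b x f) (?D R) \<and>
      (\<forall>a'\<in>?D R. (\<lambda>k. norm (expansion_term n q \<alpha> b x f a' k)) summable_on multi_indices n)"
  then obtain R where R: "R > 0" and a: "a \<in> ?D R"
    and lhs: "multi_analytic_on n (expansion_lhs n q \<alpha> b x f) (?D R)"
    and rhs: "multi_analytic_on n (expansion_rhs n q \<alpha> b x f) (?D R)"
    and summ: "(\<lambda>k. norm (expansion_term n q \<alpha> b x f a k)) summable_on multi_indices n"
    by blast
  have lim: "(\<lambda>N. q ^ N) \<longlonglongrightarrow> 0" using assms(2) by (rule LIMSEQ_power_zero)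
  have "\<forall>\<^sub>F N in sequentially. norm (\<alpha> * q ^ N * x r) < 1" for r
  proof -
    have "(\<lambda>N. norm (\<alpha> * q ^ N * x r)) \<longlonglongrightarrow> norm (\<alpha> * 0 * x r)"
      by (intro tendsto_intros lim)
    then show ?thesis by (rule order_tendstoD) simp
  qed
  then have "\<forall>\<^sub>F N in sequentially. \<forall>r\<in>{1..n}. norm (\<alpha> * q ^ N * x r) < 1"
    by (simp add: eventually_ball_finite_distrib)
  moreover have "\<forall>\<^sub>F N in sequentially. norm (q ^ N) < R"
    using order_tendstoD(2)[OF tendsto_norm[OF lim]] R by simp
  ultimately have "\<forall>\<^sub>F N in sequentially. N > 0 \<and> norm (q ^ N) < R \<and> (\<forall>r\<in>{1..n}. norm (\<alpha> * q ^ N * x r) < 1)"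
    using eventually_gt_at_top[of 0] by eventually_elim simp
  \<comment> \<open>Beyond K the powers of q qualify for the terminating case, lie in the disc, and
    keep the denominators that depend on a away from zero.\<close>
  then obtain K where K: "\<And>N. N \<ge> K \<Longrightarrow> N > 0 \<and> norm (q ^ N) < R \<and> (\<forall>r\<in>{1..n}. norm (\<alpha> * q ^ N * x r) < 1)"
    unfolding eventually_sequentially by blast
  define U where "U = (\<lambda>N. q ^ N) ` {K..}"
  have "expansion_rhs n q \<alpha> b x f a = expansion_lhs n q \<alpha> b x f a"
  proof (rule multi_analytic_identity[OF rhs lhs R _ _ _ a])
    show "U \<subseteq> ball 0 R" using K by (auto simp: U_def)
    show "0 islimpt U"
      unfolding islimpt_approachable
    proof (intro allI impI)
      fix e :: real assume "e > 0"
      then have "\<forall>\<^sub>F N in sequentially. norm (q ^ N) < e"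
        using order_tendstoD(2)[OF tendsto_norm[OF lim]] by simp
      then have "\<forall>\<^sub>F N in sequentially. norm (q ^ N) < e \<and> N \<ge> K"
        using eventually_ge_at_top[of K] by eventually_elim simp
      then obtain N where "norm (q ^ N) < e" "N \<ge> K"
        using eventually_happens'[OF sequentially_bot] by blast
      then show "\<exists>y\<in>U. y \<noteq> 0 \<and> dist y 0 < e"
        using assms(1) by (auto simp: U_def intro!: bexI[of _ "q ^ N"])
    qed
    fix a' assume a': "\<And>r. r \<in> {1..n} \<Longrightarrow> a' r \<in> U"
    then have "\<forall>r\<in>{1..n}. \<exists>N. N \<ge> K \<and> a' r = q ^ N"
      by (simp only: U_def image_iff Bex_def atLeast_iff) blast
    then obtain N where N: "\<And>r. r \<in> {1..n} \<Longrightarrow> N r \<ge> K \<and> a' r = q ^ N r" by metis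
    \<comment> \<open>The hypothesis concerns a, not a'. Only (\<alpha> a_r x_r)_\<infinity> and
      (\<alpha> x_r a_r)_j change with the point.\<close>
    have "denominators_nonzero n q \<alpha> b x a'"
    proof -
      have "norm (\<alpha> * a' r * x r) < 1" if "r \<in> {1..n}" for r
        using N[OF that] K that by auto
      then have "qpoch_inf q (\<alpha> * a' r * x r) \<noteq> 0 \<and> qpoch q (\<alpha> * x r * a' r) j \<noteq> 0" if "r \<in> {1..n}" for r j
        using qpoch_nonzero[OF assms(2), of "\<alpha> * a' r * x r"] that by (simp add: mult_ac)
      then show ?thesis
        using assms(4) unfolding denominators_nonzero_def by blast
    qed
    then have "(expansion_term n q \<alpha> b x f a' has_sum expansion_lhs n q \<alpha> b x f a') (multi_indices n)"
      using N K by (intro expansion_terminating[where N = N] assms) auto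
    then show "expansion_rhs n q \<alpha> b x f a' = expansion_lhs n q \<alpha> b x f a'"
      unfolding expansion_rhs_def by (rule infsumI)
  qed
  \<comment> \<open>An infinite sum that does not converge has the default value 0, so equality of
    the two functions does not by itself give convergence at a.\<close>
  moreover have "expansion_term n q \<alpha> b x f a summable_on multi_indices n"
    using summ by (rule abs_summable_summable)
  ultimately show ?thesis
    unfolding expansion_rhs_def by (metis has_sum_infsum)
qed

end
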